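(* Consider two policies $\pi_1$ and $\pi_2$. Assume that the transition matrix $P_{\pi_2}$ of policy $\pi_2$ satisfies the drift condition: there exist a Lyapunov function $\mathcal V:\mathcal X\to[1,\infty)$, constants $\varepsilon\in(0,1)$ and $b\ge0$, and a finite set $C\subset\mathcal X$ with $$\sum_{y\in\mathcal X}P_{\pi_2}(x,y)\mathcal V(y)\le\varepsilon\mathcal V(x)+b\,\mathbb I_C(x)\quad\text{for each }x\in\mathcal X,$$ and that the cost function satisfies $|g|\le\mathcal V$. Assume also that the transition matrix $P_{\pi_1}$ of policy $\pi_1$ is positive recurrent and has stationary distribution $d_{\pi_1}$. Then the ergodicity coefficient $\tau_{1,\mathcal V}[D_{\pi_2}]$ is finite and the following bound on the difference of average returns of the two policies holds: $$\eta_{\pi_2}-\eta_{\pi_1}\le \mathbb E_{x\sim d_{\pi_1},\,a\sim\pi_1(\cdot|x)}\left[\frac{\pi_2(a|x)}{\pi_1(a|x)}A_{\pi_1}(x,a)\right]+2\,\epsilon_{\pi_2,\mathcal V}\,\tau_{1,\mathcal V}[D_{\pi_2}]\ \mathbb E_{x\sim d_{\pi_1},\,a\sim\pi_1(\cdot|x),\,y\sim P(\cdot|x,a)}\left[\left|\frac{\pi_2(a|x)}{\pi_1(a|x)}-1\right|\mathcal V(y)\right],$$ where $\epsilon_{\pi_2,\mathcal V}=\sup_{x\in\mathcal X}\frac{1}{\mathcal V(x)}\left|\mathbb E_{a\sim\pi_2(\cdot|x)}[A_{\pi_1}(x,a)]\right|$.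
   Context: Setting: a Markov decision process with countable state space $\mathcal X$, finite action space $\mathcal A$, one-step cost function $g:\mathcal X\times\mathcal A\to\mathbb R$ (possibly unbounded), transition function $P(\cdot|x,a)$, initial state distribution $\mu$, and long-run average cost $\eta_\pi=\lim_{N\to\infty}\frac1N\mathbb E_\pi[\sum_{t=0}^{N-1}g(x^{(t)},a^{(t)})\mid x^{(0)}\sim\mu]$ of a stationary randomized policy $\pi$. The transition matrix of $\pi$ is $P_\pi(x,y)=\sum_{a\in\mathcal A}\pi(a|x)P(y|x,a)$, and $d_\pi$ denotes its stationary distribution. The Markov chains induced by policies are irreducible and aperiodic. $|g|\le\mathcal V$ means $|g(x,a)|\le\mathcal V(x)$ for all $(x,a)$. $\mathbb I_C$ is the indicator function of $C$. Relative value function: $V_\pi(x)=\lim_{N\to\infty}\mathbb E_\pi[\sum_{t=0}^{N-1}(g(x^{(t)},a^{(t)})-\eta_\pi)\mid x^{(0)}=x]$; relative advantage function: $A_\pi(x,a)=g(x,a)-\eta_\pi+\sum_{y\in\mathcal X}P(y|x,a)V_\pi(y)-V_\pi(x)$. $D_{\pi_2}$ is the group inverse of $I-P_{\pi_2}$, i.e. $D_{\pi_2}=Z_{\pi_2}-e\,d_{\pi_2}^T$, where $Z_{\pi_2}=\sum_{t=0}^\infty(P_{\pi_2}-e\,d_{\pi_2}^T)^t$ is the fundamental matrix and $e$ is the all-ones vector. The $\mathcal V$-weighted one-norm ergodicity coefficient of a matrix $A$ on $\mathcal X\times\mathcal X$ is $$\tau_{1,\mathcal V}[A]=\sup\{\|A^Tx\|_{1,\mathcal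 V}:\|x\|_{1,\mathcal V}=1,\ x^Te=0\}=\sup_{x,y\in\mathcal X}\frac{1}{\mathcal V(x)+\mathcal V(y)}\sum_{z\in\mathcal X}|A(x,z)-A(y,z)|\mathcal V(z),$$ where $\|\nu\|_{1,\mathcal V}=\sum_{x\in\mathcal X}|\nu(x)|\mathcal V(x)$ for $\nu:\mathcal X\to\mathbb R$.
   Formalization: Three assumptions are added, without which the claim can fail: π2(a|x)=0 whenever π1(a|x)=0; the Lyapunov function has finite mean under the initial distribution μ; and the relative value function of π1 is integrable under the stationary distribution of π2. *)

theory Defs
  imports "HOL-Probability.Probability" "HOL-Library.Monad_Syntax"
begin

section \<open>Markov kernels on a countable state space\<close>

primrec kernel_pow :: "('x \<Rightarrow> 'x pmf) \<Rightarrow> nat \<Rightarrow> 'x \<Rightarrow> 'x pmf" where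
  "kernel_pow K 0 x = return_pmf x"
| "kernel_pow K (Suc n) x = bind_pmf (K x) (kernel_pow K n)"

definition irreducible_kernel :: "('x \<Rightarrow> 'x pmf) \<Rightarrow> bool" where
  "irreducible_kernel K \<longleftrightarrow> (\<forall>x y. \<exists>n. pmf (kernel_pow K n x) y > 0)"

definition aperiodic_kernel :: "('x \<Rightarrow> 'x pmf) \<Rightarrow> bool" where
  "aperiodic_kernel K \<longleftrightarrow> (\<forall>x. Gcd {n. n > 0 \<and> pmf (kernel_pow K n x) x > 0} = 1)"

text \<open>\<open>first_passage K x n y\<close> is the probability that the chain started at \<open>y\<close> visits \<open>x\<close>
  at time \<open>n\<close> for the first time after time \<open>0\<close>.\<close>

fun first_passage :: "('x \<Rightarrow> 'x pmf) \<Rightarrow> 'x \<Rightarrow> nat \<Rightarrow> 'x \<Rightarrow> real" where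
  "first_passage K x 0 y = 0"
| "first_passage K x (Suc 0) y = pmf (K y) x"
| "first_passage K x (Suc (Suc n)) y =
     (\<integral>z. (if z = x then 0 else first_passage K x (Suc n) z) \<partial>measure_pmf (K y))"

definition positive_recurrent :: "('x \<Rightarrow> 'x pmf) \<Rightarrow> bool" where
  "positive_recurrent K \<longleftrightarrow>
     (\<forall>x. (\<lambda>n. first_passage K x n x) sums 1 \<and> summable (\<lambda>n. real n * first_passage K x n x))"

definition stationary :: "('x \<Rightarrow> 'x pmf) \<Rightarrow> 'x pmf \<Rightarrow> bool" where
  "stationary K d \<longleftrightarrow> bind_pmf d K = d"

definition stat_dist :: "('x \<Rightarrow> 'x pmf) \<Rightarrow> 'x pmf" where
  "stat_dist K = (THE d. stationary K d)"

text \<open>The left-hand side is a nonnegative integral, so the condition includes its finiteness.\<close>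

definition drift_condition ::
  "('x \<Rightarrow> 'x pmf) \<Rightarrow> ('x \<Rightarrow> real) \<Rightarrow> real \<Rightarrow> real \<Rightarrow> 'x set \<Rightarrow> bool" where
  "drift_condition K V \<epsilon> b C \<longleftrightarrow>
     (\<forall>x. (\<integral>\<^sup>+y. ennreal (V y) \<partial>measure_pmf (K x)) \<le> ennreal (\<epsilon> * V x + b * indicator C x))"

section \<open>Matrices indexed by the state space\<close>

definition mat_id :: "'x \<Rightarrow> 'x \<Rightarrow> real" where
  "mat_id x y = (if x = y then 1 else 0)"

definition mat_mult :: "('x \<Rightarrow> 'x \<Rightarrow> real) \<Rightarrow> ('x \<Rightarrow> 'x \<Rightarrow> real) \<Rightarrow> 'x \<Rightarrow> 'x \<Rightarrow> real" where
  "mat_mult A B x z = (\<Sum>\<^sub>\<infinity>y. A x y * B y z)"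

primrec mat_pow :: "('x \<Rightarrow> 'x \<Rightarrow> real) \<Rightarrow> nat \<Rightarrow> 'x \<Rightarrow> 'x \<Rightarrow> real" where
  "mat_pow A 0 = mat_id"
| "mat_pow A (Suc n) = mat_mult A (mat_pow A n)"

definition transpose_apply :: "('x \<Rightarrow> 'x \<Rightarrow> real) \<Rightarrow> ('x \<Rightarrow> real) \<Rightarrow> 'x \<Rightarrow> real" where
  "transpose_apply A \<nu> z = (\<Sum>\<^sub>\<infinity>x. A x z * \<nu> x)"

definition weighted_norm1 :: "('x \<Rightarrow> real) \<Rightarrow> ('x \<Rightarrow> real) \<Rightarrow> ennreal" where
  "weighted_norm1 V \<nu> = (\<Sum>\<^sub>\<infinity>x. ennreal (\<bar>\<nu> x\<bar> * V x))"

text \<open>For \<open>V \<ge> 1\<close> a vector of weighted norm \<open>1\<close> is absolutely summable, so its sum is a genuine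
  one. On a one-point state space the supremum is over the empty set and equals \<open>0\<close>.\<close>

definition ergodicity_coeff :: "('x \<Rightarrow> real) \<Rightarrow> ('x \<Rightarrow> 'x \<Rightarrow> real) \<Rightarrow> ennreal" where
  "ergodicity_coeff V A =
     (SUP \<nu> \<in> {\<nu>. weighted_norm1 V \<nu> = 1 \<and> (\<Sum>\<^sub>\<infinity>x. \<nu> x) = 0}.
        weighted_norm1 V (transpose_apply A \<nu>))"

definition fundamental_matrix :: "('x \<Rightarrow> 'x pmf) \<Rightarrow> 'x \<Rightarrow> 'x \<Rightarrow> real" where
  "fundamental_matrix K x y =
     (\<Sum>t. mat_pow (\<lambda>u v. pmf (K u) v - pmf (stat_dist K) v) t x y)"

definition group_inverse :: "('x \<Rightarrow> 'x pmf) \<Rightarrow> 'x \<Rightarrow> 'x \<Rightarrow> real" where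
  "group_inverse K x y = fundamental_matrix K x y - pmf (stat_dist K) y"

section \<open>Markov decision processes\<close>

text \<open>\<open>P x a\<close> is the law of the next state, \<open>\<pi> x\<close> the law of the action chosen in state \<open>x\<close>.\<close>

definition policy_kernel ::
  "('x \<Rightarrow> 'a \<Rightarrow> 'x pmf) \<Rightarrow> ('x \<Rightarrow> 'a pmf) \<Rightarrow> 'x \<Rightarrow> 'x pmf" where
  "policy_kernel P \<pi> x = bind_pmf (\<pi> x) (P x)"

text \<open>Joint law of the first \<open>N\<close> state-action pairs, started at \<open>x\<close>.\<close>

primrec trajectory ::
  "('x \<Rightarrow> 'a \<Rightarrow> 'x pmf) \<Rightarrow> ('x \<Rightarrow> 'a pmf) \<Rightarrow> nat \<Rightarrow> 'x \<Rightarrow> ('x \<times> 'a) list pmf" where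
  "trajectory P \<pi> 0 x = return_pmf []"
| "trajectory P \<pi> (Suc N) x =
     do { a \<leftarrow> \<pi> x; y \<leftarrow> P x a; h \<leftarrow> trajectory P \<pi> N y; return_pmf ((x, a) # h) }"

definition expected_total ::
  "('x \<Rightarrow> 'a \<Rightarrow> 'x pmf) \<Rightarrow> ('x \<Rightarrow> 'a pmf) \<Rightarrow> ('x \<Rightarrow> 'a \<Rightarrow> real) \<Rightarrow> 'x pmf \<Rightarrow> nat \<Rightarrow> real" where
  "expected_total P \<pi> f \<mu> N =
     (\<integral>h. (\<Sum>(x, a)\<leftarrow>h. f x a) \<partial>measure_pmf (bind_pmf \<mu> (trajectory P \<pi> N)))"

definition avg_cost ::
  "('x \<Rightarrow> 'a \<Rightarrow> 'x pmf) \<Rightarrow> ('x \<Rightarrow> 'a \<Rightarrow> real) \<Rightarrow> 'x pmf \<Rightarrow> ('x \<Rightarrow> 'a pmf) \<Rightarrow> real" where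
  "avg_cost P g \<mu> \<pi> = lim (\<lambda>N. expected_total P \<pi> g \<mu> N / real N)"

definition rel_value ::
  "('x \<Rightarrow> 'a \<Rightarrow> 'x pmf) \<Rightarrow> ('x \<Rightarrow> 'a \<Rightarrow> real) \<Rightarrow> 'x pmf \<Rightarrow> ('x \<Rightarrow> 'a pmf) \<Rightarrow> 'x \<Rightarrow> real" where
  "rel_value P g \<mu> \<pi> x =
     lim (\<lambda>N. expected_total P \<pi> (\<lambda>y a. g y a - avg_cost P g \<mu> \<pi>) (return_pmf x) N)"

definition advantage ::
  "('x \<Rightarrow> 'a \<Rightarrow> 'x pmf) \<Rightarrow> ('x \<Rightarrow> 'a \<Rightarrow> real) \<Rightarrow> 'x pmf \<Rightarrow> ('x \<Rightarrow> 'a pmf) \<Rightarrow> 'x \<Rightarrow> 'a \<Rightarrow> real" where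
  "advantage P g \<mu> \<pi> x a =
     g x a - avg_cost P g \<mu> \<pi> + (\<integral>y. rel_value P g \<mu> \<pi> y \<partial>measure_pmf (P x a))
       - rel_value P g \<mu> \<pi> x"

text \<open>\<open>advantage_sup P g \<mu> \<pi>\<^sub>1 \<pi>\<^sub>2 V\<close> is the \<open>V\<close>-weighted supremum norm of the \<open>\<pi>\<^sub>2\<close>-average
  of the advantage function of \<open>\<pi>\<^sub>1\<close>; it may be infinite.\<close>

definition advantage_sup ::
  "('x \<Rightarrow> 'a \<Rightarrow> 'x pmf) \<Rightarrow> ('x \<Rightarrow> 'a \<Rightarrow> real) \<Rightarrow> 'x pmf \<Rightarrow> ('x \<Rightarrow> 'a pmf) \<Rightarrow> ('x \<Rightarrow> 'a pmf)
     \<Rightarrow> ('x \<Rightarrow> real) \<Rightarrow> ennreal" where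
  "advantage_sup P g \<mu> \<pi>\<^sub>1 \<pi>\<^sub>2 V =
     (SUP x. ennreal (1 / V x * \<bar>\<integral>a. advantage P g \<mu> \<pi>\<^sub>1 x a \<partial>measure_pmf (\<pi>\<^sub>2 x)\<bar>))"

end

theory Submission
  imports Defs
begin

text \<open>
  Let \<open>K\<^sub>1\<close> and \<open>K\<close> be the kernels of \<open>\<pi>\<^sub>1\<close> and \<open>\<pi>\<^sub>2\<close>, \<open>d\<close> the stationary distribution of \<open>K\<close>,
  and \<open>A\<close> the \<open>\<pi>\<^sub>2\<close>-average of the advantage of \<open>\<pi>\<^sub>1\<close>. Since \<open>d\<close> is \<open>K\<close>-invariant, the relative
  value function cancels and \<open>d(A)\<close> is exactly the difference of the average costs, so it
  remains to bound \<open>d(A) - d\<^sub>1(A)\<close> by the weighted norms of \<open>A\<close> and \<open>d\<^sub>1 - d\<close>. The group inverse maps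
  \<open>d\<^sub>1 - d\<^sub>1 K\<close> to \<open>d\<^sub>1 - d\<close>, and \<open>d\<^sub>1 - d\<^sub>1 K = d\<^sub>1 (K\<^sub>1 - K)\<close> is controlled by the expected deviation of
  the policies; this even gains the factor 2. Everything rests on geometric ergodicity of \<open>K\<close>:
  the drift into the finite set \<open>C\<close> makes the sublevel sets of \<open>V\<close> small for a skeleton chain,
  and drift plus minorization gives a contraction of the weighted oscillation seminorm.
\<close>

section \<open>Integration with respect to probability mass functions\<close>

text \<open>The bound lives in the extended nonnegative reals, where 0 * \<infinity> = 0, so an
  infinite factor makes it trivial only if the other factors are nonzero. This is why degenerate
  cases are treated separately: a vanishing ergodicity coefficient forces a one-point state space,
  and a vanishing expected deviation forces \<open>d\<^sub>1\<close> to be invariant for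
  \<open>K\<close>. Otherwise the bound is infinite or all factors are finite. In the finite case
  \<open>V\<close> is \<open>d\<^sub>1\<close>-integrable, although no drift is assumed for
  \<open>K\<^sub>1\<close>: it inherits the drift of \<open>K\<close> up to an error controlled by
  the expected deviation.

  Geometric ergodicity is kept in the form of one summable sequence of rates that serves all test
  functions bounded by \<open>V\<close> at once. Indicators as test functions give existence and
  uniqueness of \<open>d\<close>; the sign of a difference times \<open>V\<close> gives weighted
  norms; summability gives absolute convergence of the series of \<open>K^t - e d^T\<close>, which
  is what the group inverse is.\<close>

lemma
  fixes f :: "'y \<Rightarrow> real"
  assumes int: "integrable (measure_pmf (bind_pmf p k)) f"
  shows integrable_bind_pmf_AE: "AE x in measure_pmf p. integrable (measure_pmf (k x)) f"
    and integrable_bind_pmf_integral: "integrable (measure_pmf p) (\<lambda>x. \<integral>y. f y \<partial>measure_pmf (k x))"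
    and integral_bind_pmf_integrable:
      "(\<integral>y. f y \<partial>measure_pmf (bind_pmf p k)) = (\<integral>x. (\<integral>y. f y \<partial>measure_pmf (k x)) \<partial>measure_pmf p)"
proof -
  \<comment> \<open>Tonelli settles nonnegative functions, with finiteness of the iterated integral
    as the only input; \<open>f\<close> is then split into positive and negative parts. Inner
    integrability holds almost everywhere only, since states outside the support of \<open>p\<close>
    are unconstrained.\<close>
  have *: "(AE x in measure_pmf p. integrable (measure_pmf (k x)) h) \<and>
      integrable (measure_pmf p) (\<lambda>x. \<integral>y. h y \<partial>measure_pmf (k x)) \<and>
      (\<integral>y. h y \<partial>measure_pmf (bind_pmf p k)) = (\<integral>x. (\<integral>y. h y \<partial>measure_pmf (k x)) \<partial>measure_pmf p)"
    if h: "integrable (measure_pmf (bind_pmf p k)) h" "\<And>y. h y \<ge> 0" for h :: "'y \<Rightarrow> real"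
  proof -
    have fin: "(\<integral>\<^sup>+x. (\<integral>\<^sup>+y. h y \<partial>measure_pmf (k x)) \<partial>measure_pmf p) < \<infinity>"
      using h by (auto simp: integrable_iff_bounded)
    hence "AE x in measure_pmf p. (\<integral>\<^sup>+y. h y \<partial>measure_pmf (k x)) \<noteq> \<infinity>"
      by (intro nn_integral_noteq_infinite) auto
    hence ae: "AE x in measure_pmf p. integrable (measure_pmf (k x)) h"
      by eventually_elim (use h in \<open>auto simp: integrable_iff_bounded top.not_eq_extremum\<close>)
    have eq: "(\<integral>\<^sup>+x. (\<integral>\<^sup>+y. h y \<partial>measure_pmf (k x)) \<partial>measure_pmf p)
        = (\<integral>\<^sup>+x. ennreal (\<integral>y. h y \<partial>measure_pmf (k x)) \<partial>measure_pmf p)"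
      by (intro nn_integral_cong_AE, use ae in eventually_elim) (simp add: nn_integral_eq_integral h)
    have i: "integrable (measure_pmf p) (\<lambda>x. \<integral>y. h y \<partial>measure_pmf (k x))"
      using fin unfolding eq by (auto simp: integrable_iff_bounded h)
    have "ennreal (\<integral>y. h y \<partial>measure_pmf (bind_pmf p k))
        = ennreal (\<integral>x. (\<integral>y. h y \<partial>measure_pmf (k x)) \<partial>measure_pmf p)"
      using eq h(2) by (simp flip: nn_integral_eq_integral[OF h(1)] nn_integral_eq_integral[OF i])
    thus ?thesis
      using ae i h by (simp add: ennreal_inj)
  qed
  let ?p = "\<lambda>y. max 0 (f y)" and ?n = "\<lambda>y. max 0 (- f y)"
  have p: "integrable (measure_pmf (bind_pmf p k)) ?p" and n: "integrable (measure_pmf (bind_pmf p k)) ?n"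
    using int by auto
  have f: "f = (\<lambda>y. ?p y - ?n y)"
    by auto
  note P = *[OF p] and N = *[OF n]
  from P N have ae: "AE x in measure_pmf p. integrable (measure_pmf (k x)) ?p \<and> integrable (measure_pmf (k x)) ?n"
    by auto
  show ae': "AE x in measure_pmf p. integrable (measure_pmf (k x)) f"
    using ae by eventually_elim (subst f, auto)
  have aeq: "AE x in measure_pmf p. (\<integral>y. f y \<partial>measure_pmf (k x))
      = (\<integral>y. ?p y \<partial>measure_pmf (k x)) - (\<integral>y. ?n y \<partial>measure_pmf (k x))"
    using ae by eventually_elim (subst f, auto)
  have "integrable (measure_pmf p) (\<lambda>x. (\<integral>y. ?p y \<partial>measure_pmf (k x)) - (\<integral>y. ?n y \<partial>measure_pmf (k x)))"
    using P N by auto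
  thus "integrable (measure_pmf p) (\<lambda>x. \<integral>y. f y \<partial>measure_pmf (k x))"
    by (rule integrable_cong_AE_imp) (use aeq in \<open>auto elim: eventually_mono\<close>)
  have "(\<integral>y. f y \<partial>measure_pmf (bind_pmf p k))
      = (\<integral>y. ?p y \<partial>measure_pmf (bind_pmf p k)) - (\<integral>y. ?n y \<partial>measure_pmf (bind_pmf p k))"
    by (subst f, rule Bochner_Integration.integral_diff[OF p n])
  also have "\<dots> = (\<integral>x. (\<integral>y. ?p y \<partial>measure_pmf (k x)) - (\<integral>y. ?n y \<partial>measure_pmf (k x)) \<partial>measure_pmf p)"
    using P N by simp
  also have "\<dots> = (\<integral>x. (\<integral>y. f y \<partial>measure_pmf (k x)) \<partial>measure_pmf p)"
    by (rule integral_cong_AE) (use aeq in \<open>auto elim: eventually_mono\<close>)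
  finally show "(\<integral>y. f y \<partial>measure_pmf (bind_pmf p k))
      = (\<integral>x. (\<integral>y. f y \<partial>measure_pmf (k x)) \<partial>measure_pmf p)" .
qed

lemma integrable_pmf_bounded:
  fixes f :: "'y \<Rightarrow> real"
  assumes "integrable (measure_pmf p) h" "\<And>x. \<bar>f x\<bar> \<le> h x"
  shows "integrable (measure_pmf p) f"
  by (rule Bochner_Integration.integrable_bound[OF assms(1)])
    (use assms(2) in \<open>auto intro!: always_eventually order_trans[OF assms(2)]\<close>)

lemma integrable_bind_pmfI:
  fixes f h :: "'y \<Rightarrow> real"
  assumes nonneg: "\<And>y. 0 \<le> f y"
    and int: "\<And>x. x \<in> set_pmf p \<Longrightarrow> integrable (measure_pmf (k x)) f"
    and h: "integrable (measure_pmf p) h"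
    and le: "\<And>x. x \<in> set_pmf p \<Longrightarrow> (\<integral>y. f y \<partial>measure_pmf (k x)) \<le> h x"
  shows "integrable (measure_pmf (bind_pmf p k)) f"
proof -
  have "(\<integral>\<^sup>+x. (\<integral>\<^sup>+y. f y \<partial>measure_pmf (k x)) \<partial>measure_pmf p) \<le> (\<integral>\<^sup>+x. ennreal (h x) \<partial>measure_pmf p)"
    by (intro nn_integral_mono_AE)
      (auto simp: AE_measure_pmf_iff nn_integral_eq_integral int nonneg intro!: ennreal_leI le)
  also have "\<dots> \<le> (\<integral>\<^sup>+x. ennreal (norm (h x)) \<partial>measure_pmf p)"
    by (intro nn_integral_mono ennreal_leI) auto
  also have "\<dots> < \<infinity>"
    using h by (auto simp: integrable_iff_bounded)
  finally show ?thesis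
    by (auto simp: integrable_iff_bounded nonneg)
qed

lemma has_sum_integral_measure_pmf:
  fixes f :: "'y \<Rightarrow> real"
  assumes "integrable (measure_pmf p) f"
  shows "((\<lambda>x. pmf p x * f x) has_sum (\<integral>x. f x \<partial>measure_pmf p)) UNIV"
proof -
  have i: "integrable (count_space UNIV) (\<lambda>x. pmf p x * f x)"
    using assms unfolding measure_pmf_eq_density by (subst (asm) integrable_density) auto
  hence a: "Infinite_Set_Sum.abs_summable_on (\<lambda>x. pmf p x * f x) UNIV"
    by (simp add: Infinite_Set_Sum.abs_summable_on_def)
  have "(\<integral>x. f x \<partial>measure_pmf p) = infsetsum (\<lambda>x. pmf p x * f x) UNIV"
    unfolding infsetsum_def measure_pmf_eq_density by (subst integral_density) auto
  also have "\<dots> = (\<Sum>\<^sub>\<infinity>x. pmf p x * f x)"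
    using a by (rule infsetsum_infsum)
  finally show ?thesis
    using a by (simp add: abs_summable_summable has_sum_infsum flip: abs_summable_equivalent)
qed

text \<open>Brings the unordered sum in \<open>weighted_norm1\<close> within reach of Tonelli and
  monotone convergence. Countability enters through \<open>to_nat\<close>, which exhausts the type
  by an increasing sequence of finite sets.\<close>

lemma infsum_ennreal_eq_nn_integral:
  fixes f :: "'x::countable \<Rightarrow> ennreal"
  shows "(\<Sum>\<^sub>\<infinity>x. f x) = (\<integral>\<^sup>+x. f x \<partial>count_space UNIV)"
proof (rule antisym)
  have fin: "(\<Sum>x\<in>F. f x) = (\<integral>\<^sup>+x. f x * indicator F x \<partial>count_space UNIV)" if "finite F" for F
    using that by (simp add: nn_integral_count_space_indicator[symmetric] nn_integral_count_space_finite)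
  show "(\<Sum>\<^sub>\<infinity>x. f x) \<le> (\<integral>\<^sup>+x. f x \<partial>count_space UNIV)"
    by (subst nonneg_infsum_complete)
      (auto intro!: SUP_least nn_integral_mono simp: fin split: split_indicator)
  define A where "A n = {x::'x. to_nat x < n}" for n
  have A: "finite (A n)" for n
    unfolding A_def by (rule finite_imageD[of to_nat]) (auto intro: finite_subset[of _ "{..<n}"] inj_on_subset[OF inj_to_nat])
  have "(\<integral>\<^sup>+x. f x \<partial>count_space UNIV) = (\<integral>\<^sup>+x. (SUP n. f x * indicator (A n) x) \<partial>count_space UNIV)"
  proof (intro nn_integral_cong antisym)
    fix x
    show "f x \<le> (SUP n. f x * indicator (A n) x)"
      by (rule SUP_upper2[of "Suc (to_nat x)"]) (auto simp: A_def)
  qed (auto intro!: SUP_least split: split_indicator)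
  also have "\<dots> = (SUP n. \<integral>\<^sup>+x. f x * indicator (A n) x \<partial>count_space UNIV)"
    by (intro nn_integral_monotone_convergence_SUP)
      (auto simp: incseq_def le_fun_def A_def split: split_indicator)
  also have "\<dots> = (SUP n. \<Sum>x\<in>A n. f x)"
    by (simp add: fin A)
  also have "\<dots> \<le> (\<Sum>\<^sub>\<infinity>x. f x)"
    by (subst nonneg_infsum_complete) (auto intro!: SUP_least intro: SUP_upper2 A)
  finally show "(\<integral>\<^sup>+x. f x \<partial>count_space UNIV) \<le> (\<Sum>\<^sub>\<infinity>x. f x)" .
qed

lemma weighted_norm1_nn_integral:
  fixes \<nu> :: "'x::countable \<Rightarrow> real"
  shows "weighted_norm1 V \<nu> = (\<integral>\<^sup>+x. ennreal (\<bar>\<nu> x\<bar> * V x) \<partial>count_space UNIV)"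
  unfolding weighted_norm1_def by (rule infsum_ennreal_eq_nn_integral)

section \<open>Powers of a kernel\<close>

lemma kernel_pow_add: "kernel_pow K (m + n) x = bind_pmf (kernel_pow K m x) (kernel_pow K n)"
  by (induction m arbitrary: x) (auto simp: bind_return_pmf bind_assoc_pmf intro!: bind_pmf_cong)

lemma kernel_pow_one [simp]: "kernel_pow K (Suc 0) = K"
proof
  have [simp]: "kernel_pow K 0 = return_pmf"
    by (rule ext) simp
  show "kernel_pow K (Suc 0) x = K x" for x
    by (simp add: bind_return_pmf')
qed

lemma kernel_pow_Suc': "kernel_pow K (Suc n) x = bind_pmf (kernel_pow K n x) K"
  using kernel_pow_add[of K n 1 x] by simp

text \<open>Chapman-Kolmogorov, keeping only the paths that are in \<open>y\<close> at time
  \<open>m\<close>.\<close>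

lemma pmf_kernel_pow_add_ge:
  "pmf (kernel_pow K m x) y * pmf (kernel_pow K n y) z \<le> pmf (kernel_pow K (m + n) x) z"
proof -
  have "ennreal (pmf (kernel_pow K m x) y * pmf (kernel_pow K n y) z)
      = (\<integral>\<^sup>+u. ennreal (pmf (kernel_pow K n u) z) * indicator {y} u \<partial>measure_pmf (kernel_pow K m x))"
    by (subst nn_integral_indicator_singleton) (auto simp: ennreal_mult' emeasure_pmf_single mult.commute)
  also have "\<dots> \<le> (\<integral>\<^sup>+u. ennreal (pmf (kernel_pow K n u) z) \<partial>measure_pmf (kernel_pow K m x))"
    by (intro nn_integral_mono) (auto split: split_indicator)
  also have "\<dots> = pmf (kernel_pow K (m + n) x) z"
    by (simp add: kernel_pow_add ennreal_pmf_bind)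
  finally show ?thesis
    by simp
qed

lemma stationary_kernel_pow:
  assumes "stationary K d"
  shows "bind_pmf d (kernel_pow K n) = d"
proof (induction n)
  case (Suc n)
  have "bind_pmf d (kernel_pow K (Suc n)) = bind_pmf (bind_pmf d K) (kernel_pow K n)"
    unfolding bind_assoc_pmf by (intro bind_pmf_cong) auto
  with Suc assms show ?case
    unfolding stationary_def by metis
next
  case 0
  have "kernel_pow K 0 = return_pmf"
    by (rule ext) simp
  thus ?case
    by (simp add: bind_return_pmf')
qed

text \<open>Some state carries mass, an \<open>n\<close>-step path moves part of it to
  \<open>y\<close>, and \<open>d\<close> is unchanged by \<open>n\<close> steps. Used to turn a
  statement that holds \<open>d\<close>-almost everywhere into one about every state.\<close>

lemma stationary_irreducible_pos:
  assumes "stationary K d" "irreducible_kernel K"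
  shows "pmf d y > 0"
proof -
  obtain x where x: "x \<in> set_pmf d"
    using set_pmf_not_empty[of d] by blast
  obtain n where "pmf (kernel_pow K n x) y > 0"
    using assms(2) unfolding irreducible_kernel_def by blast
  hence "y \<in> set_pmf (bind_pmf d (kernel_pow K n))"
    using x by (auto simp flip: pmf_positive_iff)
  thus ?thesis
    using stationary_kernel_pow[OF assms(1)] by (simp add: pmf_positive)
qed

section \<open>Additive sets of natural numbers\<close>

text \<open>The least positive difference of two elements of \<open>S\<close> with 0 adjoined
  divides every element of \<open>S\<close>, so it is 1. Hence two consecutive numbers
  \<open>a\<close> and \<open>a + 1\<close> are available, and their nonnegative combinations cover
  everything from \<open>a * a\<close> on.\<close>

lemma eventually_in_additive_set:
  fixes S :: "nat set"
  assumes add: "\<And>a b. a \<in> S \<Longrightarrow> b \<in> S \<Longrightarrow> a + b \<in> S" and gcd: "Gcd S = 1"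
  shows "\<exists>M. \<forall>m\<ge>M. m \<in> S"
proof -
  define T where "T = insert 0 S"
  have "S \<subseteq> T"
    by (auto simp: T_def)
  have T_add: "a + b \<in> T" if "a \<in> T" "b \<in> T" for a b
    using that add by (auto simp: T_def)
  have T_mult: "k * a \<in> T" if "a \<in> T" for a k :: nat
    using that by (induction k) (auto intro: T_add, simp add: T_def)
  define D where "D = {d. d > 0 \<and> (\<exists>a\<in>T. a + d \<in> T)}"
  have "S \<noteq> {} \<and> S \<noteq> {0}"
    using gcd by auto
  then obtain s where s: "s \<in> S" "s > 0"
    by auto
  hence "s \<in> D"
    unfolding D_def by (auto simp: T_def intro!: bexI[of _ 0])
  define d where "d = (LEAST d. d \<in> D)"
  have "d \<in> D"
    unfolding d_def using \<open>s \<in> D\<close> by (rule LeastI)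
  then obtain a where a: "a \<in> T" "a + d \<in> T" and "d > 0"
    by (auto simp: D_def)
  have min: "d \<le> d'" if "d' \<in> D" for d'
    unfolding d_def using that by (rule Least_le)
  \<comment> \<open>the set of differences is closed under division with remainder\<close>
  have "d dvd t" if "t \<in> S" for t
  proof (rule ccontr)
    assume "\<not> d dvd t"
    hence r: "0 < t mod d" "t mod d < d"
      using \<open>d > 0\<close> by (auto simp: mod_greater_zero_iff_not_dvd)
    have "(t div d) * (a + d) + t mod d = (t div d) * a + t"
      by (simp add: algebra_simps)
    moreover have "(t div d) * a + t \<in> T" "(t div d) * (a + d) \<in> T"
      using that a by (auto intro!: T_add T_mult simp: \<open>S \<subseteq> T\<close>[THEN subsetD])
    ultimately have "t mod d \<in> D"
      using r unfolding D_def by (metis (mono_tags, lifting) mem_Collect_eq)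
    with min r show False
      by fastforce
  qed
  hence "d dvd Gcd S"
    by (rule Gcd_greatest)
  with gcd have "d = 1"
    by simp
  with a have a1: "a + 1 \<in> T"
    by simp
  \<comment> \<open>For \<open>a > 0\<close>, \<open>m = q * a + r * (a + 1)\<close> with
    \<open>r = m mod a\<close> and \<open>q = m div a - r\<close>, where
    \<open>m \<ge> a * a\<close> keeps \<open>q\<close> nonnegative. The extra 1 makes
    \<open>m\<close> positive, so that membership in \<open>T\<close> is membership in
    \<open>S\<close>.\<close>
  have "m \<in> S" if m: "m \<ge> a * a + 1" for m
  proof -
    have "m \<in> T"
    proof (cases "a = 0")
      case True
      with True a1 T_mult[of 1 m] show ?thesis by simp
    next
      case False
      have "m mod a < a" "a \<le> m div a"
        using False m by (auto simp: less_eq_div_iff_mult_less_eq)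
      then obtain q where q: "m div a = q + m mod a"
        using le_Suc_ex[of "m mod a" "m div a"] by (auto simp: add.commute)
      have "m = (m div a) * a + m mod a"
        by simp
      also have "\<dots> = q * a + (m mod a) * (a + 1)"
        by (subst q) (simp add: algebra_simps)
      also have "\<dots> \<in> T"
        by (rule T_add[OF T_mult[OF a(1)] T_mult[OF a1]])
      finally show ?thesis .
    qed
    thus ?thesis
      using m by (simp add: T_def)
  qed
  thus ?thesis
    by blast
qed

text \<open>By aperiodicity the return times to \<open>y\<close> form an additive set with greatest
  common divisor 1; a fixed path from \<open>x\<close> to \<open>y\<close> in front only shifts the
  threshold.\<close>

lemma eventually_kernel_pow_pos:
  assumes "irreducible_kernel K" "aperiodic_kernel K"
  shows "\<exists>M. \<forall>m\<ge>M. pmf (kernel_pow K m x) y > 0"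
proof -
  define S where "S = {n. n > 0 \<and> pmf (kernel_pow K n y) y > 0}"
  have "\<exists>M. \<forall>m\<ge>M. m \<in> S"
  proof (rule eventually_in_additive_set)
    show "Gcd S = 1"
      using assms(2) by (simp add: aperiodic_kernel_def S_def)
    show "m + n \<in> S" if "m \<in> S" "n \<in> S" for m n
      using that less_le_trans[OF mult_pos_pos pmf_kernel_pow_add_ge]
      by (auto simp: S_def)
  qed
  then obtain M where M: "pmf (kernel_pow K m y) y > 0" if "m \<ge> M" for m
    by (auto simp: S_def)
  obtain k where k: "pmf (kernel_pow K k x) y > 0"
    using assms(1) by (auto simp: irreducible_kernel_def)
  have "pmf (kernel_pow K m x) y > 0" if "m \<ge> k + M" for m
  proof -
    have "m - k \<ge> M" "k + (m - k) = m"
      using that by auto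
    thus ?thesis
      using less_le_trans[OF mult_pos_pos[OF k M] pmf_kernel_pow_add_ge, of "m - k"] by simp
  qed
  thus ?thesis
    by blast
qed

section \<open>Weighted norms\<close>

lemma integrable_count_space_pmf_iff:
  fixes f :: "'y \<Rightarrow> real"
  shows "integrable (count_space UNIV) (\<lambda>x. pmf p x * f x) \<longleftrightarrow> integrable (measure_pmf p) f"
  unfolding measure_pmf_eq_density by (subst integrable_density) auto

lemma integral_count_space_pmf:
  fixes f :: "'y \<Rightarrow> real"
  shows "(\<integral>x. pmf p x * f x \<partial>count_space UNIV) = (\<integral>x. f x \<partial>measure_pmf p)"
  unfolding measure_pmf_eq_density by (subst integral_density) auto

text \<open>If the sum does not converge, both sides take the default value 0, so the identity is
  unconditional.\<close>

lemma infsum_eq_integral_count_space: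
  fixes f :: "'y \<Rightarrow> real"
  shows "(\<Sum>\<^sub>\<infinity>x. f x) = (\<integral>x. f x \<partial>count_space UNIV)"
proof -
  have iff: "f summable_on UNIV \<longleftrightarrow> Infinite_Set_Sum.abs_summable_on f UNIV"
    by (rule trans[OF summable_on_iff_abs_summable_on_real abs_summable_equivalent])
  show ?thesis
  proof (cases "f summable_on UNIV")
    case True
    hence "infsetsum f UNIV = (\<Sum>\<^sub>\<infinity>x. f x)"
      unfolding iff by (rule infsetsum_infsum)
    thus ?thesis
      by (simp add: infsetsum_def)
  next
    case False
    hence "\<not> integrable (count_space UNIV) f"
      unfolding iff Infinite_Set_Sum.abs_summable_on_def .
    thus ?thesis
      using False by (simp add: infsum_not_exists not_integrable_integral_eq)
  qed
qed

lemma infsum_pmf_diff: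
  fixes f :: "'y \<Rightarrow> real"
  assumes "integrable (measure_pmf p) f" "integrable (measure_pmf q) f"
  shows "(\<Sum>\<^sub>\<infinity>x. (pmf p x - pmf q x) * f x) = (\<integral>x. f x \<partial>measure_pmf p) - (\<integral>x. f x \<partial>measure_pmf q)"
  unfolding infsum_eq_integral_count_space left_diff_distrib
  using assms by (simp add: integrable_count_space_pmf_iff integral_count_space_pmf)

text \<open>Among test functions bounded by \<open>V\<close>, the sign of the difference times
  \<open>V\<close> attains the norm. A bound that is uniform in such test functions is therefore a
  bound on the weighted norm.\<close>

lemma weighted_norm1_pmf_diff:
  fixes p q :: "'x::countable pmf"
  assumes V: "\<And>x. V x \<ge> 0" and "integrable (measure_pmf p) V" "integrable (measure_pmf q) V"
  defines "f \<equiv> \<lambda>x. sgn (pmf p x - pmf q x) * V x"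
  shows "weighted_norm1 V (\<lambda>x. pmf p x - pmf q x)
    = ennreal ((\<integral>x. f x \<partial>measure_pmf p) - (\<integral>x. f x \<partial>measure_pmf q))"
proof -
  have int: "integrable (measure_pmf p) f" "integrable (measure_pmf q) f"
    by (rule integrable_pmf_bounded[where h = V]; use assms in \<open>auto simp: abs_mult sgn_if\<close>)+
  have eq: "\<bar>pmf p x - pmf q x\<bar> * V x = pmf p x * f x - pmf q x * f x" for x
    by (simp add: f_def sgn_if algebra_simps)
  have "integrable (count_space UNIV) (\<lambda>x. \<bar>pmf p x - pmf q x\<bar> * V x)"
    using int unfolding eq by (simp add: integrable_count_space_pmf_iff)
  hence "weighted_norm1 V (\<lambda>x. pmf p x - pmf q x)
      = ennreal (\<integral>x. pmf p x * f x - pmf q x * f x \<partial>count_space UNIV)"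
    unfolding weighted_norm1_nn_integral eq[symmetric] using V by (intro nn_integral_eq_integral) auto
  thus ?thesis
    using int by (simp add: integrable_count_space_pmf_iff integral_count_space_pmf)
qed

lemma weighted_norm1_pmf_diff_less_top:
  fixes p q :: "'x::countable pmf"
  assumes "\<And>x. V x \<ge> 0" "integrable (measure_pmf p) V" "integrable (measure_pmf q) V"
  shows "weighted_norm1 V (\<lambda>x. pmf p x - pmf q x) < \<infinity>"
  using weighted_norm1_pmf_diff[OF assms] by simp

text \<open>The other half of the duality. Only one sign is controlled, because
  \<open>ennreal\<close> sends negative numbers to 0; exchanging \<open>p\<close> and
  \<open>q\<close> gives the other.\<close>

lemma integral_diff_le_weighted_norm1:
  fixes p q :: "'x::countable pmf" and h :: "'x \<Rightarrow> real"
  assumes V: "\<And>x. V x \<ge> 0" and p: "integrable (measure_pmf p) V" and q: "integrable (measure_pmf q) V"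
    and h: "\<And>x. \<bar>h x\<bar> \<le> c * V x" and c: "c \<ge> 0"
  shows "ennreal ((\<integral>x. h x \<partial>measure_pmf p) - (\<integral>x. h x \<partial>measure_pmf q))
    \<le> ennreal c * weighted_norm1 V (\<lambda>x. pmf p x - pmf q x)"
proof -
  have int: "integrable (measure_pmf p) h" "integrable (measure_pmf q) h"
    by (rule integrable_pmf_bounded[OF _ h]; use p q in auto)+
  have "ennreal ((\<integral>x. h x \<partial>measure_pmf p) - (\<integral>x. h x \<partial>measure_pmf q))
      = ennreal (\<integral>x. pmf p x * h x - pmf q x * h x \<partial>count_space UNIV)"
    using int by (simp add: integrable_count_space_pmf_iff integral_count_space_pmf)
  also have "\<dots> \<le> ennreal (norm (\<integral>x. pmf p x * h x - pmf q x * h x \<partial>count_space UNIV))"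
    by (intro ennreal_leI) auto
  also have "\<dots> \<le> (\<integral>\<^sup>+x. norm (pmf p x * h x - pmf q x * h x) \<partial>count_space UNIV)"
    using int by (intro integral_norm_bound_ennreal) (simp add: integrable_count_space_pmf_iff)
  also have "\<dots> \<le> (\<integral>\<^sup>+x. ennreal c * ennreal (\<bar>pmf p x - pmf q x\<bar> * V x) \<partial>count_space UNIV)"
  proof (intro nn_integral_mono)
    fix x
    have "\<bar>pmf p x - pmf q x\<bar> * \<bar>h x\<bar> \<le> \<bar>pmf p x - pmf q x\<bar> * (c * V x)"
      using h by (intro mult_left_mono) auto
    thus "ennreal (norm (pmf p x * h x - pmf q x * h x)) \<le> ennreal c * ennreal (\<bar>pmf p x - pmf q x\<bar> * V x)"
      using c V by (simp add: ennreal_mult[symmetric] abs_mult[symmetric] left_diff_distrib mult.left_commute)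
  qed
  also have "\<dots> = ennreal c * weighted_norm1 V (\<lambda>x. pmf p x - pmf q x)"
    unfolding weighted_norm1_nn_integral by (rule nn_integral_cmult) simp
  finally show ?thesis .
qed

lemma weighted_norm1_cmult:
  fixes \<nu> :: "'x::countable \<Rightarrow> real"
  shows "weighted_norm1 V (\<lambda>x. c * \<nu> x) = ennreal \<bar>c\<bar> * weighted_norm1 V \<nu>"
  unfolding weighted_norm1_nn_integral
  by (subst nn_integral_cmult[symmetric]) (auto simp: abs_mult mult.assoc ennreal_mult')

lemma weighted_norm1_eq_0_iff:
  fixes \<nu> :: "'x::countable \<Rightarrow> real"
  assumes "\<And>x. V x > 0"
  shows "weighted_norm1 V \<nu> = 0 \<longleftrightarrow> (\<forall>x. \<nu> x = 0)"
proof -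
  have "\<not> V x \<le> 0" for x
    using assms[of x] by simp
  thus ?thesis
    unfolding weighted_norm1_nn_integral
    by (subst nn_integral_0_iff_AE) (auto simp: AE_count_space ennreal_eq_0_iff mult_le_0_iff less_imp_le[OF assms])
qed

text \<open>After exchanging the two summations, a weighted bound on the rows becomes an operator
  bound on the transpose.\<close>

lemma weighted_norm1_transpose_apply_le:
  fixes \<nu> :: "'x::countable \<Rightarrow> real"
  assumes V: "\<And>x. V x \<ge> 0" and c: "c \<ge> 0"
    and row: "\<And>x. weighted_norm1 V (A x) \<le> ennreal (c * V x)"
  shows "weighted_norm1 V (transpose_apply A \<nu>) \<le> ennreal c * weighted_norm1 V \<nu>"
proof -
  have "ennreal (\<bar>transpose_apply A \<nu> z\<bar> * V z)
      \<le> (\<integral>\<^sup>+x. ennreal (\<bar>A x z\<bar> * V z) * ennreal \<bar>\<nu> x\<bar> \<partial>count_space UNIV)" for z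
  proof -
    have "ennreal \<bar>transpose_apply A \<nu> z\<bar> \<le> (\<integral>\<^sup>+x. ennreal \<bar>A x z * \<nu> x\<bar> \<partial>count_space UNIV)"
    \<comment> \<open>A column sum that does not converge has the default value 0, for which the
      bound is trivial.\<close>
    proof (cases "integrable (count_space UNIV) (\<lambda>x. A x z * \<nu> x)")
      case True
      thus ?thesis
        unfolding transpose_apply_def infsum_eq_integral_count_space
        using integral_norm_bound_ennreal[OF True] by simp
    qed (simp add: transpose_apply_def infsum_eq_integral_count_space not_integrable_integral_eq)
    hence "ennreal (V z) * ennreal \<bar>transpose_apply A \<nu> z\<bar>
        \<le> ennreal (V z) * (\<integral>\<^sup>+x. ennreal \<bar>A x z * \<nu> x\<bar> \<partial>count_space UNIV)"
      by (intro mult_left_mono) auto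
    also have "\<dots> = (\<integral>\<^sup>+x. ennreal (\<bar>A x z\<bar> * V z) * ennreal \<bar>\<nu> x\<bar> \<partial>count_space UNIV)"
      by (subst nn_integral_cmult[symmetric])
        (auto simp: V ennreal_mult[symmetric] abs_mult ac_simps)
    finally show ?thesis
      by (simp add: V ennreal_mult[symmetric] mult.commute)
  qed
  hence "weighted_norm1 V (transpose_apply A \<nu>)
      \<le> (\<integral>\<^sup>+z. (\<integral>\<^sup>+x. ennreal (\<bar>A x z\<bar> * V z) * ennreal \<bar>\<nu> x\<bar> \<partial>count_space UNIV) \<partial>count_space UNIV)"
    unfolding weighted_norm1_nn_integral by (intro nn_integral_mono)
  also have "\<dots> = (\<integral>\<^sup>+x. (\<integral>\<^sup>+z. ennreal (\<bar>A x z\<bar> * V z) * ennreal \<bar>\<nu> x\<bar> \<partial>count_space UNIV) \<partial>count_space UNIV)"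
    using nn_integral_fst_count_space[of "\<lambda>(x, z). ennreal (\<bar>A x z\<bar> * V z) * ennreal \<bar>\<nu> x\<bar>"]
      nn_integral_snd_count_space[of "\<lambda>(x, z). ennreal (\<bar>A x z\<bar> * V z) * ennreal \<bar>\<nu> x\<bar>"] by simp
  also have "\<dots> = (\<integral>\<^sup>+x. weighted_norm1 V (A x) * ennreal \<bar>\<nu> x\<bar> \<partial>count_space UNIV)"
    unfolding weighted_norm1_nn_integral by (intro nn_integral_cong nn_integral_multc) auto
  also have "\<dots> \<le> (\<integral>\<^sup>+x. ennreal c * ennreal (\<bar>\<nu> x\<bar> * V x) \<partial>count_space UNIV)"
  proof (intro nn_integral_mono)
    fix x
    have "weighted_norm1 V (A x) * ennreal \<bar>\<nu> x\<bar> \<le> ennreal (c * V x) * ennreal \<bar>\<nu> x\<bar>"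
      by (intro mult_right_mono row) auto
    also have "\<dots> = ennreal c * ennreal (\<bar>\<nu> x\<bar> * V x)"
      using V c by (simp add: ennreal_mult[symmetric] ac_simps)
    finally show "weighted_norm1 V (A x) * ennreal \<bar>\<nu> x\<bar> \<le> ennreal c * ennreal (\<bar>\<nu> x\<bar> * V x)" .
  qed
  also have "\<dots> = ennreal c * weighted_norm1 V \<nu>"
    unfolding weighted_norm1_nn_integral by (rule nn_integral_cmult) simp
  finally show ?thesis .
qed

text \<open>Homogeneity: the supremum ranges over vectors of norm exactly 1, so \<open>\<nu>\<close>
  is divided by its norm \<open>m\<close>. Finiteness and the separate case of norm 0 make this
  division possible.\<close>

lemma weighted_norm1_transpose_apply_le_ergodicity_coeff:
  fixes \<nu> :: "'x::countable \<Rightarrow> real"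
  assumes V: "\<And>x. V x > 0" and fin: "weighted_norm1 V \<nu> < \<infinity>" and sum: "(\<Sum>\<^sub>\<infinity>x. \<nu> x) = 0"
  shows "weighted_norm1 V (transpose_apply A \<nu>) \<le> ergodicity_coeff V A * weighted_norm1 V \<nu>"
proof (cases "weighted_norm1 V \<nu> = 0")
  case True
  hence "transpose_apply A \<nu> = (\<lambda>x. 0)"
    using weighted_norm1_eq_0_iff[of V \<nu>] V by (simp add: transpose_apply_def fun_eq_iff)
  thus ?thesis
    by (simp add: weighted_norm1_def)
next
  case False
  then obtain m where m: "m > 0" "weighted_norm1 V \<nu> = ennreal m"
    using fin by (metis ennreal_cases ennreal_eq_0_iff infinity_ennreal_def less_irrefl linorder_not_le)
  define \<nu>' where "\<nu>' = (\<lambda>x. (1 / m) * \<nu> x)"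
  have "weighted_norm1 V \<nu>' = 1"
    unfolding \<nu>'_def weighted_norm1_cmult using m by (simp flip: ennreal_mult)
  moreover have "(\<Sum>\<^sub>\<infinity>x. \<nu>' x) = 0"
    unfolding \<nu>'_def infsum_cmult_right' sum by simp
  ultimately have "weighted_norm1 V (transpose_apply A \<nu>') \<le> ergodicity_coeff V A"
    unfolding ergodicity_coeff_def by (intro SUP_upper) auto
  moreover have "transpose_apply A \<nu> = (\<lambda>x. m * transpose_apply A \<nu>' x)"
    using m by (simp add: transpose_apply_def \<nu>'_def fun_eq_iff flip: infsum_cmult_right')
  hence "weighted_norm1 V (transpose_apply A \<nu>) = ennreal m * weighted_norm1 V (transpose_apply A \<nu>')"
    using m by (simp add: weighted_norm1_cmult)
  ultimately show ?thesis
    unfolding m(2) by (metis mult.commute mult_left_mono zero_le)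
qed

section \<open>Geometric ergodicity\<close>

text \<open>Hairer and Mattingly's contraction argument, in terms of test functions instead of couplings.\<close>

lemma oscillation_bound_centered:
  fixes \<phi> W :: "'y \<Rightarrow> real"
  assumes "\<And>x y. \<bar>\<phi> x - \<phi> y\<bar> \<le> W x + W y"
  obtains c where "\<And>x. \<bar>\<phi> x - c\<bar> \<le> W x"
proof
  \<comment> \<open>The intervals with centre \<open>\<phi> x\<close> and radius \<open>W x\<close>
    meet pairwise; on the line they then share a point, for instance the supremum of their left
    ends.\<close>
  define c where "c = (SUP x. \<phi> x - W x)"
  have le: "\<phi> x - W x \<le> \<phi> y + W y" for x y
    using assms[of x y] by linarith
  have "bdd_above (range (\<lambda>x. \<phi> x - W x))"
    using le[of _ undefined] by (intro bdd_aboveI2)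
  hence "\<phi> x - W x \<le> c" for x
    unfolding c_def by (rule cSUP_upper[OF UNIV_I])
  moreover have "c \<le> \<phi> y + W y" for y
    unfolding c_def using le by (intro cSUP_least) auto
  ultimately show "\<bar>\<phi> x - c\<bar> \<le> W x" for x
    by (smt (verit))
qed

text \<open>Measured in the weight \<open>1 + \<beta> * V\<close>, pairs with large
  \<open>V x + V y\<close> contract by the drift alone; for the other pairs both kernels put mass at
  least \<open>\<delta>\<close> on the same state \<open>z\<close>, and this mass cancels in the
  difference. Beyond \<open>4 * B / (1 - \<gamma>)\<close> half of the drift gap pays for the
  additive error \<open>2 * B\<close> of the pair.\<close>

lemma drift_minorization_contraction:
  fixes Q :: "'y \<Rightarrow> 'y pmf" and V :: "'y \<Rightarrow> real"
  assumes V: "\<And>x. V x \<ge> 1" and int: "\<And>x. integrable (measure_pmf (Q x)) V"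
    and drift: "\<And>x. (\<integral>y. V y \<partial>measure_pmf (Q x)) \<le> \<gamma> * V x + B"
    and \<gamma>: "0 < \<gamma>" "\<gamma> < 1" and B: "B \<ge> 0" and \<delta>: "\<delta> > 0"
    and minor: "\<And>x. V x \<le> 4 * B / (1 - \<gamma>) + 1 \<Longrightarrow> pmf (Q x) z \<ge> \<delta>"
  obtains \<beta> \<rho> :: real where "\<beta> > 0" "0 < \<rho>" "\<rho> < 1"
    "\<And>\<phi> L x y. (\<And>x y. \<bar>\<phi> x - \<phi> y\<bar> \<le> L * ((1 + \<beta> * V x) + (1 + \<beta> * V y))) \<Longrightarrow>
      \<bar>(\<integral>u. \<phi> u \<partial>measure_pmf (Q x)) - (\<integral>u. \<phi> u \<partial>measure_pmf (Q y))\<bar>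
        \<le> \<rho> * L * ((1 + \<beta> * V x) + (1 + \<beta> * V y))"
proof -
  \<comment> \<open>Each constant serves one estimate.
    \<open>\<beta> * (2 * B) \<le> \<delta>\<close> lets the additive drift error consume at most
    half of the \<open>2 * \<delta>\<close> gained from the common mass. \<open>\<kappa>\<close> is
    half the drift gap; the other half absorbs \<open>2 * B\<close> for far pairs.
    \<open>\<eta> * (2 + \<beta>) = \<beta> * \<kappa>\<close> turns a gain in \<open>V\<close>
    alone into a gain in the whole weight. \<open>\<rho>\<close> is the worst of the resulting
    rates.\<close>
  define \<beta> where "\<beta> = \<delta> / (2 * B + 1)"
  define \<kappa> where "\<kappa> = (1 - \<gamma>) / 2"
  define \<eta> where "\<eta> = \<beta> * \<kappa> / (2 + \<beta>)"
  define \<rho> where "\<rho> = max \<gamma> (max (1 - \<delta> / 2) (1 - \<eta>))"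
  define W where "W x = 1 + \<beta> * V x" for x
  have \<beta>: "\<beta> > 0" "\<beta> * (2 * B) \<le> \<delta>"
    using \<delta> B by (auto simp: \<beta>_def field_simps)
  have \<kappa>: "\<kappa> > 0" "\<gamma> = 1 - 2 * \<kappa>"
    using \<gamma> by (auto simp: \<kappa>_def field_simps)
  have \<eta>: "\<eta> > 0" "\<eta> * (2 + \<beta>) = \<beta> * \<kappa>"
    using \<kappa> \<beta> by (auto simp: \<eta>_def)
  have \<rho>: "\<rho> > 0" "\<rho> < 1" "\<gamma> \<le> \<rho>" "1 - \<delta> / 2 \<le> \<rho>" "1 - \<eta> \<le> \<rho>"
    using \<gamma> \<eta> \<delta> by (auto simp: \<rho>_def)
  have W_pos: "W x \<ge> 1" for x
    using V[of x] \<beta> by (auto simp: W_def)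
  have W_int: "integrable (measure_pmf (Q x)) W" for x
    unfolding W_def using int by auto
  have QW: "(\<integral>u. W u \<partial>measure_pmf (Q x)) \<le> 1 + \<beta> * (\<gamma> * V x + B)" for x
    unfolding W_def using int drift[of x] \<beta> by simp
  show thesis
  proof (rule that[OF \<beta>(1) \<rho>(1,2)])
    fix \<phi> :: "'y \<Rightarrow> real" and L x y
    assume osc: "\<And>x y. \<bar>\<phi> x - \<phi> y\<bar> \<le> L * ((1 + \<beta> * V x) + (1 + \<beta> * V y))"
    have "0 \<le> L * (W x + W x)"
      using osc[of x x] by (simp add: W_def)
    hence L: "L \<ge> 0"
      using W_pos[of x] by (simp add: zero_le_mult_iff)
    \<comment> \<open>Subtracting a constant leaves the difference of the two integrals unchanged
      and turns the pairwise bound into a pointwise one.\<close>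
    obtain c where c: "\<bar>\<phi> x - c\<bar> \<le> L * W x" for x
      using oscillation_bound_centered[of \<phi> "\<lambda>x. L * W x"] osc by (auto simp: W_def algebra_simps)
    define \<psi> where "\<psi> x = \<phi> x - c" for x
    have \<psi>_le: "\<bar>\<psi> x\<bar> \<le> L * W x" for x
      using c by (simp add: \<psi>_def)
    have \<psi>_int: "integrable (measure_pmf (Q x)) \<psi>" for x
      by (rule integrable_pmf_bounded[OF _ \<psi>_le]) (use W_int in auto)
    have \<phi>_int: "(\<integral>u. \<phi> u \<partial>measure_pmf (Q x)) = (\<integral>u. \<psi> u \<partial>measure_pmf (Q x)) + c" for x
    proof -
      have "(\<integral>u. \<phi> u \<partial>measure_pmf (Q x)) = (\<integral>u. \<psi> u + c \<partial>measure_pmf (Q x))"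
        by (simp add: \<psi>_def)
      thus ?thesis
        using \<psi>_int by simp
    qed
    define S where "S = V x + V y"
    have S: "S \<ge> 2"
      using V[of x] V[of y] by (simp add: S_def)
    have bound: "\<bar>(\<integral>u. \<psi> u \<partial>measure_pmf (Q x)) - (\<integral>u. \<psi> u \<partial>measure_pmf (Q y))\<bar>
        \<le> L * (\<rho> * (2 + \<beta> * S))"
    proof (cases "S \<le> 4 * B / (1 - \<gamma>) + 1")
      case True
      have x: "pmf (Q x) z \<ge> \<delta>" and y: "pmf (Q y) z \<ge> \<delta>"
        using True V[of x] V[of y] by (auto intro!: minor simp: S_def)
      \<comment> \<open>After removal of the mass \<open>\<delta>\<close> at \<open>z\<close> the
        kernel is still a nonnegative measure, so the pointwise bound on \<open>\<psi>\<close> may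
        be integrated against it. The removed terms \<open>\<delta> * \<psi> z\<close> agree for the
        two starting states.\<close>
      have mass: "\<bar>(\<integral>u. \<psi> u \<partial>measure_pmf (Q x)) - \<delta> * \<psi> z\<bar>
          \<le> L * ((\<integral>u. W u \<partial>measure_pmf (Q x)) - \<delta> * W z)" if "pmf (Q x) z \<ge> \<delta>" for x
      proof -
        let ?p = "pmf (Q x) z"
        let ?r = "\<lambda>f::'y \<Rightarrow> real. \<integral>u. f u * (1 - indicator {z} u) \<partial>measure_pmf (Q x)"
        have i: "integrable (measure_pmf (Q x)) (\<lambda>u. f u * indicator {z} u)" for f :: "'y \<Rightarrow> real"
          by (rule integrable_pmf_bounded[of _ "\<lambda>_. \<bar>f z\<bar>"]) (auto split: split_indicator)
        have "(\<integral>u. f u * indicator {z} u \<partial>measure_pmf (Q x)) = f z * ?p" for f :: "'y \<Rightarrow> real"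
        proof -
          have "(\<integral>u. f u * indicator {z} u \<partial>measure_pmf (Q x)) = (\<integral>u. f z * indicator {z} u \<partial>measure_pmf (Q x))"
            by (intro Bochner_Integration.integral_cong) (auto split: split_indicator)
          thus ?thesis
            by (simp add: measure_pmf_single)
        qed
        hence split: "(\<integral>u. f u \<partial>measure_pmf (Q x)) = ?r f + f z * ?p"
            and int': "integrable (measure_pmf (Q x)) (\<lambda>u. f u * (1 - indicator {z} u))"
          if "integrable (measure_pmf (Q x)) f" for f :: "'y \<Rightarrow> real"
          using i[of f] that by (simp_all add: algebra_simps)
        have "\<bar>?r \<psi>\<bar> \<le> ?r (\<lambda>u. L * W u)"
        proof (rule order_trans[OF integral_abs_bound integral_mono])
          show "integrable (measure_pmf (Q x)) (\<lambda>u. L * W u * (1 - indicator {z} u))"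
            by (rule int') (use W_int in auto)
          show "integrable (measure_pmf (Q x)) (\<lambda>u. \<bar>\<psi> u * (1 - indicator {z} u)\<bar>)"
            using int'[OF \<psi>_int] by auto
        qed (use \<psi>_le in \<open>auto split: split_indicator\<close>)
        moreover have "?r (\<lambda>u. L * W u) = L * ?r W"
          by (simp add: mult.assoc)
        ultimately have 1: "\<bar>?r \<psi>\<bar> \<le> L * ?r W"
          by simp
        have 2: "\<bar>(?p - \<delta>) * \<psi> z\<bar> \<le> (?p - \<delta>) * (L * W z)"
          using that \<psi>_le[of z] by (simp add: abs_mult mult_left_mono)
        have "\<bar>?r \<psi> + (?p - \<delta>) * \<psi> z\<bar> \<le> L * ?r W + (?p - \<delta>) * (L * W z)"
          using 1 2 by linarith
        thus ?thesis
          using split[OF \<psi>_int] split[OF W_int] by (simp add: algebra_simps)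
      qed
      have "\<bar>(\<integral>u. \<psi> u \<partial>measure_pmf (Q x)) - (\<integral>u. \<psi> u \<partial>measure_pmf (Q y))\<bar>
          \<le> L * ((\<integral>u. W u \<partial>measure_pmf (Q x)) - \<delta> * W z) + L * ((\<integral>u. W u \<partial>measure_pmf (Q y)) - \<delta> * W z)"
        using mass[OF x] mass[OF y] by linarith
      also have "\<dots> = L * ((\<integral>u. W u \<partial>measure_pmf (Q x)) + (\<integral>u. W u \<partial>measure_pmf (Q y)) - 2 * \<delta> * W z)"
        by (simp add: algebra_simps)
      also have "\<dots> \<le> L * (\<rho> * (2 + \<beta> * S))"
      proof (rule mult_left_mono[OF _ L])
        have "\<delta> * 1 \<le> \<delta> * W z"
          using W_pos[of z] \<delta> by (intro mult_left_mono) auto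
        hence "(\<integral>u. W u \<partial>measure_pmf (Q x)) + (\<integral>u. W u \<partial>measure_pmf (Q y)) - 2 * \<delta> * W z
            \<le> 2 + \<gamma> * (\<beta> * S) + \<beta> * (2 * B) - 2 * \<delta>"
          using QW[of x] QW[of y] by (simp add: S_def algebra_simps)
        also have "\<dots> \<le> 2 * (1 - \<delta> / 2) + \<gamma> * (\<beta> * S)"
          using \<beta> by simp
        also have "\<dots> \<le> 2 * \<rho> + \<rho> * (\<beta> * S)"
          using \<rho> \<beta> S by (intro add_mono mult_left_mono mult_right_mono) auto
        finally show "(\<integral>u. W u \<partial>measure_pmf (Q x)) + (\<integral>u. W u \<partial>measure_pmf (Q y)) - 2 * \<delta> * W z
            \<le> \<rho> * (2 + \<beta> * S)"
          by (simp add: algebra_simps)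
      qed
      finally show ?thesis .
    next
      case False
      hence "4 * B \<le> (1 - \<gamma>) * S"
        using \<gamma> by (simp add: field_simps)
      hence SB: "2 * B \<le> \<kappa> * S"
        using \<kappa> by (simp add: mult.commute)
      have mass: "\<bar>\<integral>u. \<psi> u \<partial>measure_pmf (Q x)\<bar> \<le> L * (\<integral>u. W u \<partial>measure_pmf (Q x))" for x
      proof -
        have "\<bar>\<integral>u. \<psi> u \<partial>measure_pmf (Q x)\<bar> \<le> (\<integral>u. L * W u \<partial>measure_pmf (Q x))"
          by (rule order_trans[OF integral_abs_bound integral_mono])
            (use \<psi>_le \<psi>_int W_int in auto)
        thus ?thesis by simp
      qed
      have "\<bar>(\<integral>u. \<psi> u \<partial>measure_pmf (Q x)) - (\<integral>u. \<psi> u \<partial>measure_pmf (Q y))\<bar>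
          \<le> L * ((\<integral>u. W u \<partial>measure_pmf (Q x)) + (\<integral>u. W u \<partial>measure_pmf (Q y)))"
        using mass[of x] mass[of y] by (simp add: algebra_simps)
      also have "\<dots> \<le> L * (\<rho> * (2 + \<beta> * S))"
      proof (rule mult_left_mono[OF _ L])
        have "(\<integral>u. W u \<partial>measure_pmf (Q x)) + (\<integral>u. W u \<partial>measure_pmf (Q y))
            \<le> 2 + \<beta> * (\<gamma> * S + 2 * B)"
          using QW[of x] QW[of y] by (simp add: S_def algebra_simps)
        also have "\<dots> \<le> 2 + \<beta> * ((1 - \<kappa>) * S)"
        proof -
          have "\<gamma> * S = S - 2 * (\<kappa> * S)"
            by (simp add: \<kappa>(2) algebra_simps)
          thus ?thesis
            using SB \<beta> by (intro add_mono mult_left_mono) (auto simp: algebra_simps)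
        qed
        also have "\<dots> \<le> (1 - \<eta>) * (2 + \<beta> * S)"
        proof -
          have "\<eta> * 2 * 1 + \<eta> * \<beta> * S \<le> \<eta> * 2 * S + \<eta> * \<beta> * S"
            using S \<eta> by (intro add_right_mono mult_left_mono) auto
          also have "\<dots> = \<eta> * (2 + \<beta>) * S"
            by (simp add: algebra_simps)
          also have "\<dots> = \<beta> * \<kappa> * S"
            by (simp only: \<eta>(2))
          finally show ?thesis
            by (simp add: algebra_simps)
        qed
        also have "\<dots> \<le> \<rho> * (2 + \<beta> * S)"
          using \<rho> \<beta> S by (intro mult_right_mono) auto
        finally show "(\<integral>u. W u \<partial>measure_pmf (Q x)) + (\<integral>u. W u \<partial>measure_pmf (Q y)) \<le> \<rho> * (2 + \<beta> * S)" .
      qed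
      finally show ?thesis .
    qed
    show "\<bar>(\<integral>u. \<phi> u \<partial>measure_pmf (Q x)) - (\<integral>u. \<phi> u \<partial>measure_pmf (Q y))\<bar>
        \<le> \<rho> * L * ((1 + \<beta> * V x) + (1 + \<beta> * V y))"
      using bound unfolding \<phi>_int by (simp add: S_def algebra_simps)
  qed
qed

text \<open>\<open>n div N\<close> exceeds \<open>n / N - 1\<close>, so up to a constant the terms
  lie below a geometric series whose ratio is the \<open>N\<close>-th root of \<open>\<rho>\<close>.
  Needed because the contraction acts only once in \<open>N\<close> steps.\<close>

lemma summable_power_div:
  fixes \<rho> :: real
  assumes "0 < \<rho>" "\<rho> < 1" "N > 0"
  shows "summable (\<lambda>n. \<rho> ^ (n div N))"
proof -
  define q where "q = root N \<rho>"
  have q: "0 < q" "q < 1" "q ^ N = \<rho>"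
    using assms by (auto simp: q_def)
  show ?thesis
  proof (rule summable_comparison_test'[where N = 0])
    show "summable (\<lambda>n. q ^ n / q ^ N)"
      using q by (intro summable_divide summable_geometric) auto
    fix n
    have "\<rho> ^ (n div N) * q ^ N = q ^ (N * (n div N) + N)"
      unfolding q(3)[symmetric] by (simp add: power_mult power_add)
    also have "\<dots> \<le> q ^ n"
      using q assms(3) dividend_less_times_div[of N n] by (intro power_decreasing) auto
    finally show "norm (\<rho> ^ (n div N)) \<le> q ^ n / q ^ N"
      using q assms by (simp add: field_simps)
  qed
qed

section \<open>Moments, minorization and decay of oscillations under the drift condition\<close>

locale drift_chain =
  fixes K :: "'x::countable \<Rightarrow> 'x pmf" and V :: "'x \<Rightarrow> real" and \<epsilon> b :: real and C :: "'x set"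
  assumes irr: "irreducible_kernel K" and aper: "aperiodic_kernel K"
    and V_ge_1: "\<And>x. V x \<ge> 1"
    and eps: "0 < \<epsilon>" "\<epsilon> < 1" and b: "b \<ge> 0" and C: "finite C"
    and drift: "drift_condition K V \<epsilon> b C"
begin

text \<open>The fixed point of \<open>v \<mapsto> \<epsilon> * v + b\<close>, that is,
  \<open>b\<close> summed over a geometric series; this keeps the moment bound stable under one more
  step.\<close>

definition B where "B = b / (1 - \<epsilon>)"

lemma B: "B \<ge> 0" "\<epsilon> * B + b = B"
  using eps b by (auto simp: B_def field_simps)

lemma V_pos: "V x > 0" and V_nonneg: "0 \<le> V x"
  using V_ge_1[of x] by auto

lemma integrable_K: "integrable (measure_pmf (K x)) V"
proof -
  have "(\<integral>\<^sup>+y. ennreal (V y) \<partial>measure_pmf (K x)) < \<infinity>"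
    using drift unfolding drift_condition_def by (metis ennreal_less_top infinity_ennreal_def le_less_trans)
  thus ?thesis
    by (auto simp: integrable_iff_bounded V_nonneg)
qed

lemma integral_K: "(\<integral>y. V y \<partial>measure_pmf (K x)) \<le> \<epsilon> * V x + b * indicator C x"
proof -
  have "ennreal (\<integral>y. V y \<partial>measure_pmf (K x)) \<le> ennreal (\<epsilon> * V x + b * indicator C x)"
    using drift unfolding drift_condition_def
    by (simp add: nn_integral_eq_integral[OF integrable_K] V_nonneg)
  moreover have "0 \<le> \<epsilon> * V x + b * indicator C x"
    using eps b V_nonneg by (intro add_nonneg_nonneg mult_nonneg_nonneg) auto
  ultimately show ?thesis
    by simp
qed

lemma integral_K': "(\<integral>y. V y \<partial>measure_pmf (K x)) \<le> \<epsilon> * V x + b"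
  using integral_K[of x] b by (auto split: split_indicator_asm)

lemma integrable_pow: "integrable (measure_pmf (kernel_pow K n x)) V"
  and integral_pow: "(\<integral>y. V y \<partial>measure_pmf (kernel_pow K n x)) \<le> \<epsilon> ^ n * V x + B"
proof -
  have "integrable (measure_pmf (kernel_pow K n x)) V \<and>
      (\<integral>y. V y \<partial>measure_pmf (kernel_pow K n x)) \<le> \<epsilon> ^ n * V x + B"
  proof (induction n)
    case 0
    show ?case
      using B by (auto intro: integrable_measure_pmf_finite)
  next
    case (Suc n)
    have i: "integrable (measure_pmf (kernel_pow K n x)) (\<lambda>y. \<epsilon> * V y + b)"
      using Suc by auto
    have int: "integrable (measure_pmf (kernel_pow K (Suc n) x)) V"
      unfolding kernel_pow_Suc'
      by (rule integrable_bind_pmfI[OF V_nonneg integrable_K i integral_K'])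
    have "(\<integral>y. V y \<partial>measure_pmf (kernel_pow K (Suc n) x))
        = (\<integral>z. (\<integral>y. V y \<partial>measure_pmf (K z)) \<partial>measure_pmf (kernel_pow K n x))"
      using int unfolding kernel_pow_Suc' by (rule integral_bind_pmf_integrable)
    also have "\<dots> \<le> (\<integral>z. \<epsilon> * V z + b \<partial>measure_pmf (kernel_pow K n x))"
      using int unfolding kernel_pow_Suc'
      by (intro integral_mono integral_K' i) (rule integrable_bind_pmf_integral)
    also have "\<dots> = \<epsilon> * (\<integral>z. V z \<partial>measure_pmf (kernel_pow K n x)) + b"
      using Suc by simp
    also have "\<dots> \<le> \<epsilon> * (\<epsilon> ^ n * V x + B) + b"
      using Suc eps by simp
    also have "\<dots> = \<epsilon> ^ Suc n * V x + B"
      using B(2) by (simp add: algebra_simps)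
    finally show ?case
      using int by simp
  qed
  thus "integrable (measure_pmf (kernel_pow K n x)) V"
    "(\<integral>y. V y \<partial>measure_pmf (kernel_pow K n x)) \<le> \<epsilon> ^ n * V x + B"
    by auto
qed

lemma integral_pow': "(\<integral>y. V y \<partial>measure_pmf (kernel_pow K n x)) \<le> (1 + B) * V x"
proof -
  have "\<epsilon> ^ n * V x \<le> 1 * V x" "B * 1 \<le> B * V x"
    using eps V_nonneg V_ge_1 B by (intro mult_right_mono mult_left_mono power_le_one; simp)+
  thus ?thesis
    using integral_pow[of n x] by (simp add: algebra_simps)
qed

text \<open>Sublevel sets of \<open>V\<close> need not be finite, but the drift carries mass from them into \<open>C\<close>.\<close>

lemma minorization:
  obtains \<delta> N z where "\<delta> > 0" "N > 0" "\<And>x. V x \<le> R \<Longrightarrow> pmf (kernel_pow K N x) z \<ge> \<delta>"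
proof -
  define z :: 'x where "z = undefined"
  obtain M where M: "\<And>c m. c \<in> C \<Longrightarrow> m \<ge> M \<Longrightarrow> pmf (kernel_pow K m c) z > 0"
  proof -
    have "\<forall>c. \<exists>M. \<forall>m\<ge>M. pmf (kernel_pow K m c) z > 0"
      using eventually_kernel_pow_pos[OF irr aper] by blast
    then obtain M where M: "\<And>c m. m \<ge> M c \<Longrightarrow> pmf (kernel_pow K m c) z > 0"
      by metis
    show thesis
    proof (rule that)
      fix c m assume "c \<in> C" "Max (M ` C) \<le> m"
      hence "M c \<le> m"
        using C by (meson Max_ge finite_imageI image_eqI order_trans)
      thus "pmf (kernel_pow K m c) z > 0"
        by (rule M)
    qed
  qed
  have "(\<lambda>n. \<epsilon> ^ n * R) \<longlonglongrightarrow> 0 * R"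
    using eps by (intro tendsto_intros LIMSEQ_power_zero) auto
  hence "eventually (\<lambda>n. \<epsilon> ^ n * R < 1 / 2) sequentially"
    by (rule order_tendstoD(2)) simp
  then obtain n\<^sub>0 where n\<^sub>0: "\<And>n. n \<ge> n\<^sub>0 \<Longrightarrow> \<epsilon> ^ n * R < 1 / 2"
    by (auto simp: eventually_sequentially)
  define n where "n = max 1 n\<^sub>0"
  have n: "\<epsilon> ^ n * R < 1 / 2" "n \<ge> 1"
    using n\<^sub>0[of n] by (auto simp: n_def)
  \<comment> \<open>The element 1 keeps \<open>D\<close> nonempty when \<open>C\<close> is empty.
    The window of times has length \<open>n\<close>, since \<open>C\<close> may be visited at any of
    the first \<open>n\<close> times, and the time left after the visit must still be at least
    \<open>M\<close>.\<close>
  define D where "D = insert 1 ((\<lambda>(c, m). pmf (kernel_pow K m c) z) ` (C \<times> {M..n + M}))"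
  define \<delta> where "\<delta> = Min D"
  have D: "finite D" "D \<noteq> {}"
    using C by (auto simp: D_def)
  have \<delta>: "\<delta> > 0"
    using D M by (auto simp: \<delta>_def D_def)
  have \<delta>_le: "\<delta> \<le> pmf (kernel_pow K m c) z" if "c \<in> C" "m \<in> {M..n + M}" for c m
    unfolding \<delta>_def using D that by (intro Min_le) (auto simp: D_def)
  \<comment> \<open>\<open>1 - \<epsilon> ^ k * V x\<close> bounds from below the probability of
    visiting \<open>C\<close> before time \<open>k\<close>: off \<open>C\<close> the drift shrinks
    the mean of \<open>V\<close> by the factor \<open>\<epsilon>\<close> per step, while
    \<open>V \<ge> 1\<close>. From \<open>C\<close>, at least \<open>M\<close> steps remain, and
    they lead to \<open>z\<close> with probability at least \<open>\<delta>\<close>. The choice of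
    \<open>n\<close> makes the bound exceed 1/2 where \<open>V x \<le> R\<close>.\<close>
  have "k \<le> n \<Longrightarrow> \<delta> * (1 - \<epsilon> ^ k * V x) \<le> pmf (kernel_pow K (k + M) x) z" for k x
  proof (induction k arbitrary: x)
    case 0
    have "\<delta> * (1 - V x) \<le> 0"
      using \<delta> V_ge_1[of x] by (simp add: mult_nonneg_nonpos)
    thus ?case
      by (simp add: order_trans[OF _ pmf_nonneg])
  next
    case (Suc k)
    show ?case
    proof (cases "x \<in> C")
      case True
      have "0 \<le> \<epsilon> ^ Suc k * V x"
        using eps V_nonneg by simp
      hence "\<delta> * (1 - \<epsilon> ^ Suc k * V x) \<le> \<delta> * 1"
        using \<delta> by (intro mult_left_mono) auto
      also have "\<dots> \<le> pmf (kernel_pow K (Suc k + M) x) z"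
        using \<delta>_le[OF True, of "Suc k + M"] Suc.prems by simp
      finally show ?thesis .
    next
      case False
      have "\<epsilon> ^ k * (\<integral>y. V y \<partial>measure_pmf (K x)) \<le> \<epsilon> ^ k * (\<epsilon> * V x)"
        using integral_K[of x] False eps by (intro mult_left_mono) auto
      hence "\<delta> * (1 - \<epsilon> ^ Suc k * V x) \<le> \<delta> * (1 - \<epsilon> ^ k * (\<integral>y. V y \<partial>measure_pmf (K x)))"
        using \<delta> by (intro mult_left_mono) (auto simp: algebra_simps)
      also have "\<dots> = (\<integral>y. \<delta> * (1 - \<epsilon> ^ k * V y) \<partial>measure_pmf (K x))"
        using integrable_K[of x] by simp
      also have "\<dots> \<le> (\<integral>y. pmf (kernel_pow K (k + M) y) z \<partial>measure_pmf (K x))"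
      proof (rule integral_mono)
        show "integrable (measure_pmf (K x)) (\<lambda>y. pmf (kernel_pow K (k + M) y) z)"
          by (rule measure_pmf.integrable_const_bound[where B = 1]) (auto simp: pmf_le_1)
      qed (use Suc integrable_K[of x] in auto)
      also have "\<dots> = pmf (kernel_pow K (Suc k + M) x) z"
        by (simp add: pmf_bind)
      finally show ?thesis .
    qed
  qed
  note main = this
  show thesis
  proof (rule that)
    show "\<delta> / 2 > 0" "n + M > 0"
      using \<delta> n by auto
    fix x assume "V x \<le> R"
    hence "\<epsilon> ^ n * V x \<le> \<epsilon> ^ n * R"
      using eps by (intro mult_left_mono) auto
    hence "\<delta> * (1 / 2) \<le> \<delta> * (1 - \<epsilon> ^ n * V x)"
      using n \<delta> by (intro mult_left_mono) auto
    with main[of n x] show "\<delta> / 2 \<le> pmf (kernel_pow K (n + M) x) z"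
      by simp
  qed
qed

lemma integrable_dominated:
  assumes "integrable (measure_pmf p) V" "\<And>x. \<bar>f x\<bar> \<le> c * V x"
  shows "integrable (measure_pmf p) f"
  by (rule integrable_pmf_bounded[OF _ assms(2)]) (use assms(1) in auto)

lemma integral_dominated:
  assumes "integrable (measure_pmf p) V" "\<And>x. \<bar>f x\<bar> \<le> c * V x"
  shows "\<bar>\<integral>x. f x \<partial>measure_pmf p\<bar> \<le> c * (\<integral>x. V x \<partial>measure_pmf p)"
proof -
  have "\<bar>\<integral>x. f x \<partial>measure_pmf p\<bar> \<le> (\<integral>x. c * V x \<partial>measure_pmf p)"
    by (rule order_trans[OF integral_abs_bound integral_mono])
      (use assms integrable_dominated[OF assms] in auto)
  thus ?thesis by simp
qed

text \<open>For \<open>n = k * N + j\<close> the contraction of the \<open>N\<close>-step chain is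
  iterated \<open>k\<close> times on the expectation of \<open>f\<close> after \<open>j\<close>
  steps. The rates \<open>s\<close> are fixed before \<open>f\<close>, which later allows test
  functions that depend on the starting state and the time.\<close>

lemma oscillation_decay:
  obtains s where "summable s" "\<And>n. s n \<ge> 0"
    "\<And>f x y n. (\<And>x. \<bar>f x\<bar> \<le> V x) \<Longrightarrow>
       \<bar>(\<integral>u. f u \<partial>measure_pmf (kernel_pow K n x)) - (\<integral>u. f u \<partial>measure_pmf (kernel_pow K n y))\<bar>
         \<le> s n * (V x + V y)"
proof -
  obtain \<delta> N z where N: "\<delta> > 0" "N > 0"
    and minor: "\<And>x. V x \<le> 4 * B / (1 - \<epsilon>) + 1 \<Longrightarrow> pmf (kernel_pow K N x) z \<ge> \<delta>"
    by (rule minorization[where R = "4 * B / (1 - \<epsilon>) + 1"]) (rule that, assumption+)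
  let ?Q = "kernel_pow K N"
  have "(\<integral>y. V y \<partial>measure_pmf (?Q x)) \<le> \<epsilon> * V x + B" for x
  proof -
    \<comment> \<open>The weaker rate \<open>\<epsilon>\<close> is kept for all \<open>N\<close>,
      because the threshold of the small set has to be fixed before \<open>N\<close> is
      known.\<close>
    have "\<epsilon> ^ N \<le> \<epsilon> ^ 1"
      using eps N by (intro power_decreasing) auto
    hence "\<epsilon> ^ N * V x \<le> \<epsilon> * V x"
      using V_nonneg by (intro mult_right_mono) auto
    with integral_pow[of N x] show ?thesis
      by simp
  qed
  from drift_minorization_contraction[of V ?Q \<epsilon> B \<delta> z, OF V_ge_1 integrable_pow this eps B(1) N(1) minor]
  obtain \<beta> \<rho> where \<beta>: "\<beta> > 0" and \<rho>: "0 < \<rho>" "\<rho> < 1" and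
    contr: "\<And>\<phi> L x y. (\<And>x y. \<bar>\<phi> x - \<phi> y\<bar> \<le> L * ((1 + \<beta> * V x) + (1 + \<beta> * V y))) \<Longrightarrow>
      \<bar>(\<integral>u. \<phi> u \<partial>measure_pmf (?Q x)) - (\<integral>u. \<phi> u \<partial>measure_pmf (?Q y))\<bar>
        \<le> \<rho> * L * ((1 + \<beta> * V x) + (1 + \<beta> * V y))"
    by metis
  \<comment> \<open>Makes \<open>L * \<beta> * V\<close> the uniform moment bound
    \<open>(1 + B) * V\<close>, so that \<open>L\<close> times the weight dominates every
    expectation of \<open>f\<close>.\<close>
  define L where "L = (1 + B) / \<beta>"
  have L: "L \<ge> 0" "L * \<beta> = 1 + B"
    using B \<beta> by (auto simp: L_def)
  let ?s = "\<lambda>n. L * (1 + \<beta>) * \<rho> ^ (n div N)"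
  show thesis
  proof (rule that)
    show "summable ?s"
      using \<rho> N by (intro summable_mult summable_power_div)
    show "?s n \<ge> 0" for n
      using L \<beta> \<rho> by simp
    fix f :: "'x \<Rightarrow> real" and x y n
    assume f: "\<And>x. \<bar>f x\<bar> \<le> V x"
    have fint: "integrable (measure_pmf (kernel_pow K m x)) f" for m x
      by (rule integrable_dominated[where c = 1, OF integrable_pow]) (use f in auto)
    have base: "\<bar>\<integral>u. f u \<partial>measure_pmf (kernel_pow K j x)\<bar> \<le> L * (1 + \<beta> * V x)" for j x
    proof -
      have "\<bar>\<integral>u. f u \<partial>measure_pmf (kernel_pow K j x)\<bar> \<le> 1 * (\<integral>u. V u \<partial>measure_pmf (kernel_pow K j x))"
        by (rule integral_dominated[OF integrable_pow]) (use f in auto)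
      also have "\<dots> \<le> L * \<beta> * V x"
        using integral_pow'[of j x] L(2) by simp
      also have "\<dots> \<le> L * (1 + \<beta> * V x)"
        using L(1) by (simp add: algebra_simps)
      finally show ?thesis .
    qed
    have iter: "\<bar>(\<integral>u. f u \<partial>measure_pmf (kernel_pow K (k * N + j) x)) -
        (\<integral>u. f u \<partial>measure_pmf (kernel_pow K (k * N + j) y))\<bar>
        \<le> \<rho> ^ k * L * ((1 + \<beta> * V x) + (1 + \<beta> * V y))" for k j x y
    proof (induction k arbitrary: x y)
      case 0
      show ?case
        using base[of j x] base[of j y] by (simp add: algebra_simps)
    next
      case (Suc k)
      have "(\<integral>u. f u \<partial>measure_pmf (kernel_pow K (Suc k * N + j) x))
          = (\<integral>v. (\<integral>u. f u \<partial>measure_pmf (kernel_pow K (k * N + j) v)) \<partial>measure_pmf (?Q x))"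
        for x
      proof -
        have "kernel_pow K (Suc k * N + j) x = bind_pmf (?Q x) (kernel_pow K (k * N + j))"
          using kernel_pow_add[of K N "k * N + j" x] by (simp add: add.assoc)
        thus ?thesis
          using integral_bind_pmf_integrable[of "?Q x" "kernel_pow K (k * N + j)" f]
            fint[of "Suc k * N + j" x] by metis
      qed
      with contr[OF Suc] show ?case
        by (simp only: power_Suc mult.assoc)
    qed
    have "\<bar>(\<integral>u. f u \<partial>measure_pmf (kernel_pow K n x)) - (\<integral>u. f u \<partial>measure_pmf (kernel_pow K n y))\<bar>
        \<le> \<rho> ^ (n div N) * L * ((1 + \<beta> * V x) + (1 + \<beta> * V y))"
      using iter[of "n div N" "n mod N" x y] by simp
    also have "\<dots> \<le> \<rho> ^ (n div N) * L * ((1 + \<beta>) * (V x + V y))"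
      using V_ge_1[of x] V_ge_1[of y] \<rho> L by (intro mult_left_mono) (auto simp: algebra_simps)
    finally show "\<bar>(\<integral>u. f u \<partial>measure_pmf (kernel_pow K n x)) - (\<integral>u. f u \<partial>measure_pmf (kernel_pow K n y))\<bar>
        \<le> ?s n * (V x + V y)"
      by (simp add: algebra_simps)
  qed
qed

end

text \<open>Integrating the drift against \<open>d\<close> suggests that
  \<open>(1 - \<epsilon>)\<close> times the mean of \<open>V\<close> is at most the mean of
  \<open>u\<close>. The error \<open>u\<close> is a function rather than a constant because the
  kernel of \<open>\<pi>\<^sub>1\<close> satisfies the drift only with an error that varies with the
  state.\<close>

lemma stationary_drift_integrable:
  fixes V :: "'y \<Rightarrow> real"
  assumes d: "stationary K d" and V: "\<And>x. V x \<ge> 0" and eps: "0 < \<epsilon>" "\<epsilon> < 1"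
    and drift: "\<And>x. (\<integral>\<^sup>+y. V y \<partial>measure_pmf (K x)) \<le> ennreal (\<epsilon> * V x) + u x"
    and u: "(\<integral>\<^sup>+x. u x \<partial>measure_pmf d) < \<infinity>"
  shows "integrable (measure_pmf d) V"
proof -
  let ?U = "\<integral>\<^sup>+x. u x \<partial>measure_pmf d"
  \<comment> \<open>\<open>V\<close> is not yet known to be \<open>d\<close>-integrable, so invariance is applied to its truncation at \<open>n\<close>\<close>
  have trunc: "(\<integral>\<^sup>+x. ennreal ((1 - \<epsilon>) * V x) * indicator {x. V x \<le> real n} x \<partial>measure_pmf d) \<le> ?U" for n
  proof -
    \<comment> \<open>One step of the chain takes the truncation \<open>?a\<close> of
      \<open>V\<close> to at most the truncation \<open>?c\<close> of \<open>\<epsilon> * V\<close>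
      plus \<open>u\<close>. The integral of \<open>?c\<close> is finite and may be cancelled, and
      where \<open>V \<le> n\<close> the difference \<open>?a - ?c\<close> is at least
      \<open>(1 - \<epsilon>) * V\<close>.\<close>
    let ?a = "\<lambda>x. min (V x) (real n)" and ?c = "\<lambda>x. min (\<epsilon> * V x) (real n)"
    have ca: "0 \<le> ?c x" "?c x \<le> ?a x" for x
      using V[of x] eps mult_right_mono[of \<epsilon> 1 "V x"] by auto
    have "(\<integral>\<^sup>+x. ?c x \<partial>measure_pmf d) \<le> (\<integral>\<^sup>+x. ennreal (real n) \<partial>measure_pmf d)"
      by (intro nn_integral_mono ennreal_leI) auto
    hence fin: "(\<integral>\<^sup>+x. ?c x \<partial>measure_pmf d) < \<infinity>"
      by (auto intro: le_less_trans)
    have "(\<integral>\<^sup>+x. ?c x \<partial>measure_pmf d) + (\<integral>\<^sup>+x. ennreal (?a x - ?c x) \<partial>measure_pmf d)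
        = (\<integral>\<^sup>+x. ?a x \<partial>measure_pmf d)"
      using ca by (subst nn_integral_add[symmetric]) (auto simp flip: ennreal_plus intro!: nn_integral_cong)
    also have "\<dots> = (\<integral>\<^sup>+x. ?a x \<partial>measure_pmf (bind_pmf d K))"
      using d by (simp add: stationary_def)
    also have "\<dots> = (\<integral>\<^sup>+x. (\<integral>\<^sup>+y. ?a y \<partial>measure_pmf (K x)) \<partial>measure_pmf d)"
      by simp
    also have "\<dots> \<le> (\<integral>\<^sup>+x. ennreal (?c x) + u x \<partial>measure_pmf d)"
    proof (intro nn_integral_mono)
      fix x
      have "(\<integral>\<^sup>+y. ?a y \<partial>measure_pmf (K x)) \<le> (\<integral>\<^sup>+y. V y \<partial>measure_pmf (K x))"
        by (intro nn_integral_mono ennreal_leI) auto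
      moreover have "(\<integral>\<^sup>+y. ?a y \<partial>measure_pmf (K x)) \<le> (\<integral>\<^sup>+y. ennreal (real n) \<partial>measure_pmf (K x))"
        by (intro nn_integral_mono ennreal_leI) auto
      ultimately have le: "(\<integral>\<^sup>+y. ?a y \<partial>measure_pmf (K x)) \<le> ennreal (\<epsilon> * V x) + u x"
        "(\<integral>\<^sup>+y. ?a y \<partial>measure_pmf (K x)) \<le> ennreal (real n)"
        using drift[of x] by (auto intro: order_trans)
      show "(\<integral>\<^sup>+y. ?a y \<partial>measure_pmf (K x)) \<le> ennreal (?c x) + u x"
      proof (cases "\<epsilon> * V x \<le> real n")
        case False
        hence "ennreal (real n) \<le> ennreal (?c x) + u x"
          by (simp add: add_increasing2)
        with le(2) show ?thesis
          by (rule order_trans)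
      qed (use le(1) in simp)
    qed
    also have "\<dots> = (\<integral>\<^sup>+x. ?c x \<partial>measure_pmf d) + ?U"
      by (rule nn_integral_add) auto
    finally have "(\<integral>\<^sup>+x. ennreal (?a x - ?c x) \<partial>measure_pmf d) \<le> ?U"
      using fin by (auto simp: ennreal_add_left_cancel_le)
    moreover have "(\<integral>\<^sup>+x. ennreal ((1 - \<epsilon>) * V x) * indicator {x. V x \<le> real n} x \<partial>measure_pmf d)
        \<le> (\<integral>\<^sup>+x. ennreal (?a x - ?c x) \<partial>measure_pmf d)"
    proof (intro nn_integral_mono)
      fix x
      have "(1 - \<epsilon>) * V x \<le> ?a x - ?c x" if "V x \<le> real n"
        using that by (simp add: algebra_simps)
      thus "ennreal ((1 - \<epsilon>) * V x) * indicator {x. V x \<le> real n} x \<le> ennreal (?a x - ?c x)"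
        by (auto split: split_indicator intro!: ennreal_leI)
    qed
    ultimately show ?thesis
      by (rule order_trans[rotated])
  qed
  have "(\<integral>\<^sup>+x. ennreal ((1 - \<epsilon>) * V x) \<partial>measure_pmf d)
      = (\<integral>\<^sup>+x. (SUP n. ennreal ((1 - \<epsilon>) * V x) * indicator {x. V x \<le> real n} x) \<partial>measure_pmf d)"
  proof (intro nn_integral_cong antisym)
    fix x
    obtain n where "V x \<le> real n"
      using real_arch_simple by blast
    thus "ennreal ((1 - \<epsilon>) * V x) \<le> (SUP n. ennreal ((1 - \<epsilon>) * V x) * indicator {x. V x \<le> real n} x)"
      by (intro SUP_upper2[of n]) auto
  qed (auto intro!: SUP_least split: split_indicator)
  also have "\<dots> = (SUP n. \<integral>\<^sup>+x. ennreal ((1 - \<epsilon>) * V x) * indicator {x. V x \<le> real n} x \<partial>measure_pmf d)"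
    by (intro nn_integral_monotone_convergence_SUP)
      (auto simp: incseq_def le_fun_def split: split_indicator)
  also have "\<dots> \<le> ?U"
    by (intro SUP_least trunc)
  also note u
  finally have "integrable (measure_pmf d) (\<lambda>x. (1 - \<epsilon>) * V x)"
    using V eps by (intro integrableI_nonneg) auto
  thus ?thesis
    using eps by simp
qed

section \<open>Convergence to the stationary distribution, its uniqueness and its existence\<close>

context drift_chain
begin

lemma integrable_bind_kernel_pow:
  assumes "integrable (measure_pmf p) V"
  shows "integrable (measure_pmf (bind_pmf p (kernel_pow K n))) V"
  by (rule integrable_bind_pmfI[OF V_nonneg integrable_pow _ integral_pow']) (use assms in simp)

lemma integrable_bind_kernel:
  assumes "integrable (measure_pmf p) V"
  shows "integrable (measure_pmf (bind_pmf p K)) V"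
  using integrable_bind_kernel_pow[OF assms, of "Suc 0"] by simp

lemma integrable_stationary:
  assumes "stationary K d"
  shows "integrable (measure_pmf d) V"
proof (rule stationary_drift_integrable[OF assms V_nonneg eps, where u = "\<lambda>_. ennreal b"])
  show "(\<integral>\<^sup>+y. V y \<partial>measure_pmf (K x)) \<le> ennreal (\<epsilon> * V x) + ennreal b" for x
    using integral_K'[of x] eps b V_nonneg
    by (simp add: nn_integral_eq_integral integrable_K ennreal_leI flip: ennreal_plus)
qed simp

text \<open>Average the oscillation bound over a second starting state with law \<open>d\<close>;
  invariance turns the averaged expectation into the stationary one. The mean of \<open>V\<close>
  under \<open>d\<close> that appears is finite and is absorbed using
  \<open>V \<ge> 1\<close>.\<close>

lemma convergence_to_stationary:
  assumes d: "stationary K d"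
  obtains s where "summable s" "\<And>n. s n \<ge> 0"
    "\<And>f x n. (\<And>x. \<bar>f x\<bar> \<le> V x) \<Longrightarrow>
       \<bar>(\<integral>u. f u \<partial>measure_pmf (kernel_pow K n x)) - (\<integral>u. f u \<partial>measure_pmf d)\<bar> \<le> s n * V x"
proof -
  obtain s where s: "summable s" "\<And>n. s n \<ge> 0"
    "\<And>f x y n. (\<And>x. \<bar>f x\<bar> \<le> V x) \<Longrightarrow>
       \<bar>(\<integral>u. f u \<partial>measure_pmf (kernel_pow K n x)) - (\<integral>u. f u \<partial>measure_pmf (kernel_pow K n y))\<bar>
         \<le> s n * (V x + V y)"
    by (rule oscillation_decay) blast
  let ?m = "\<integral>x. V x \<partial>measure_pmf d"
  have m: "?m \<ge> 0"
    using V_nonneg by (intro Bochner_Integration.integral_nonneg) auto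
  show thesis
  proof (rule that)
    show "summable (\<lambda>n. (1 + ?m) * s n)"
      using s by (intro summable_mult)
    show "(1 + ?m) * s n \<ge> 0" for n
      using m s by simp
    fix f :: "'x \<Rightarrow> real" and x n
    assume f: "\<And>x. \<bar>f x\<bar> \<le> V x"
    let ?F = "\<lambda>x. \<integral>u. f u \<partial>measure_pmf (kernel_pow K n x)"
    have dint: "integrable (measure_pmf d) V"
      using d by (rule integrable_stationary)
    have fint: "integrable (measure_pmf (bind_pmf d (kernel_pow K n))) f"
      unfolding stationary_kernel_pow[OF d] by (rule integrable_pmf_bounded[OF dint f])
    have F: "integrable (measure_pmf d) ?F" "(\<integral>u. f u \<partial>measure_pmf d) = (\<integral>y. ?F y \<partial>measure_pmf d)"
      using integrable_bind_pmf_integral[OF fint] integral_bind_pmf_integrable[OF fint]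
      unfolding stationary_kernel_pow[OF d] by auto
    have "?F x - (\<integral>u. f u \<partial>measure_pmf d) = (\<integral>y. ?F x - ?F y \<partial>measure_pmf d)"
      using F by simp
    also have "\<bar>\<dots>\<bar> \<le> (\<integral>y. s n * (V x + V y) \<partial>measure_pmf d)"
      by (rule order_trans[OF integral_abs_bound integral_mono])
        (use F dint s(3)[OF f] in auto)
    also have "\<dots> = s n * (V x + ?m * 1)"
      using dint by simp
    also have "\<dots> \<le> s n * (V x + ?m * V x)"
      using s m V_ge_1 by (intro mult_left_mono add_left_mono) auto
    finally show "\<bar>?F x - (\<integral>u. f u \<partial>measure_pmf d)\<bar> \<le> (1 + ?m) * s n * V x"
      by (simp add: algebra_simps)
  qed
qed

lemma abs_indicator_le_V: "\<bar>indicator A x\<bar> \<le> V x"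
  using V_ge_1[of x] by (auto split: split_indicator)

lemma pmf_kernel_pow_tendsto:
  assumes "stationary K d"
  shows "(\<lambda>n. pmf (kernel_pow K n x) y) \<longlonglongrightarrow> pmf d y"
proof -
  obtain s where s: "summable s"
    "\<And>f x n. (\<And>x. \<bar>f x\<bar> \<le> V x) \<Longrightarrow>
       \<bar>(\<integral>u. f u \<partial>measure_pmf (kernel_pow K n x)) - (\<integral>u. f u \<partial>measure_pmf d)\<bar> \<le> s n * V x"
    by (rule convergence_to_stationary[OF assms]) blast
  have "(\<lambda>n. s n * V x) \<longlonglongrightarrow> 0"
    using tendsto_mult_left_zero[OF summable_LIMSEQ_zero[OF s(1)]] .
  hence "(\<lambda>n. pmf (kernel_pow K n x) y - pmf d y) \<longlonglongrightarrow> 0"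
    by (rule Lim_null_comparison[rotated])
      (use s(2)[of "indicator {y}", OF abs_indicator_le_V] in \<open>auto simp: measure_pmf_single\<close>)
  thus ?thesis
    by (simp add: LIM_zero_iff)
qed

lemma stationary_unique:
  assumes "stationary K d" "stationary K d'"
  shows "d = d'"
  by (rule pmf_eqI, rule LIMSEQ_unique[OF pmf_kernel_pow_tendsto[OF assms(1), of undefined]])
    (rule pmf_kernel_pow_tendsto[OF assms(2)])

text \<open>The laws from a fixed start are Cauchy uniformly over sets: inserting \<open>k\<close>
  steps in front averages the starting state over a law whose mean of \<open>V\<close> is bounded
  independently of \<open>k\<close>. Their pointwise limit is the candidate.\<close>

lemma ex_stationary: "\<exists>d. stationary K d"
proof -
  obtain s where s: "summable s" "\<And>n. s n \<ge> 0"
    "\<And>f x y n. (\<And>x. \<bar>f x\<bar> \<le> V x) \<Longrightarrow>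
       \<bar>(\<integral>u. f u \<partial>measure_pmf (kernel_pow K n x)) - (\<integral>u. f u \<partial>measure_pmf (kernel_pow K n y))\<bar>
         \<le> s n * (V x + V y)"
    by (rule oscillation_decay) blast
  define x\<^sub>0 :: 'x where "x\<^sub>0 = undefined"
  define p where "p n = kernel_pow K n x\<^sub>0" for n
  define e where "e n = s n * (V x\<^sub>0 + (1 + B) * V x\<^sub>0)" for n
  have "e \<longlonglongrightarrow> 0"
    unfolding e_def using tendsto_mult_left_zero[OF summable_LIMSEQ_zero[OF s(1)]] .
  have cauchy: "\<bar>measure (p m) A - measure (p n) A\<bar> \<le> e n" if mn: "m \<ge> n" for m n A
  proof -
    obtain k where k: "m = k + n"
      using mn by (auto simp: le_iff_add add.commute)
    let ?F = "\<lambda>x. measure (kernel_pow K n x) A"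
    have F: "integrable (measure_pmf (p k)) ?F"
      by (rule measure_pmf.integrable_const_bound[where B = 1]) auto
    have I: "integrable (measure_pmf (bind_pmf (p k) (kernel_pow K n))) (indicator A :: 'x \<Rightarrow> real)"
      by (rule measure_pmf.integrable_const_bound[where B = 1]) auto
    have Vint: "integrable (measure_pmf (p k)) V"
      unfolding p_def by (rule integrable_pow)
    have "measure (p m) A - measure (p n) A = (\<integral>x. ?F x - ?F x\<^sub>0 \<partial>measure_pmf (p k))"
      using F integral_bind_pmf_integrable[of "p k" "kernel_pow K n" "indicator A"] I
      by (simp add: p_def k kernel_pow_add)
    also have "\<bar>\<dots>\<bar> \<le> (\<integral>x. s n * (V x\<^sub>0 + V x) \<partial>measure_pmf (p k))"
    proof (rule order_trans[OF integral_abs_bound integral_mono])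
      show "\<bar>?F x - ?F x\<^sub>0\<bar> \<le> s n * (V x\<^sub>0 + V x)" for x
        using s(3)[of "indicator A" n x x\<^sub>0, OF abs_indicator_le_V] by (simp add: add.commute)
    qed (use F Vint in auto)
    also have "\<dots> = s n * (V x\<^sub>0 + (\<integral>x. V x \<partial>measure_pmf (p k)))"
      using Vint by simp
    also have "\<dots> \<le> e n"
      unfolding e_def p_def using s(2) by (intro mult_left_mono add_left_mono integral_pow')
    finally show ?thesis .
  qed
  have "convergent (\<lambda>n. pmf (p n) y)" for y
  proof (rule Cauchy_convergent, rule metric_CauchyI)
    fix r :: real assume "r > 0"
    with \<open>e \<longlonglongrightarrow> 0\<close> have "eventually (\<lambda>n. e n < r / 2) sequentially"
      by (intro order_tendstoD) auto
    then obtain M where M: "e M < r / 2"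
      by (auto simp: eventually_sequentially)
    have "dist (pmf (p m) y) (pmf (p n) y) < r" if "m \<ge> M" "n \<ge> M" for m n
      using cauchy[OF that(1), of "{y}"] cauchy[OF that(2), of "{y}"] M
      by (auto simp: dist_real_def measure_pmf_single)
    thus "\<exists>M. \<forall>m\<ge>M. \<forall>n\<ge>M. dist (pmf (p m) y) (pmf (p n) y) < r"
      by blast
  qed
  then obtain l where l: "\<And>y. (\<lambda>n. pmf (p n) y) \<longlonglongrightarrow> l y"
    unfolding convergent_def by metis
  have l_nonneg: "l y \<ge> 0" for y
    by (rule LIMSEQ_le_const[OF l]) auto
  have l_sum: "(\<lambda>n. measure (p n) F) \<longlonglongrightarrow> (\<Sum>y\<in>F. l y)" if "finite F" for F
    using that by (simp add: measure_measure_pmf_finite tendsto_sum l)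
  have "(\<integral>\<^sup>+y. ennreal (l y) \<partial>count_space UNIV) = 1"
  proof (rule antisym)
    have eq: "(\<integral>\<^sup>+y. ennreal (l y) \<partial>count_space UNIV) = (SUP F\<in>{F. finite F \<and> F \<subseteq> UNIV}. \<Sum>y\<in>F. ennreal (l y))"
      unfolding infsum_ennreal_eq_nn_integral[symmetric] by (rule nonneg_infsum_complete) simp
    show "(\<integral>\<^sup>+y. ennreal (l y) \<partial>count_space UNIV) \<le> 1"
      unfolding eq
    proof (rule SUP_least)
      fix F :: "'x set" assume "F \<in> {F. finite F \<and> F \<subseteq> UNIV}"
      hence "(\<Sum>y\<in>F. l y) \<le> 1"
        by (intro LIMSEQ_le_const2[OF l_sum]) auto
      thus "(\<Sum>y\<in>F. ennreal (l y)) \<le> 1"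
        using l_nonneg by (simp add: sum_ennreal ennreal_le_1)
    qed
    \<comment> \<open>No mass escapes: a finite set \<open>F\<close> with almost all the mass of
      \<open>p M\<close> keeps it, up to a further small loss, at all later times, since
      \<open>cauchy\<close> is uniform in the set.\<close>
    show "1 \<le> (\<integral>\<^sup>+y. ennreal (l y) \<partial>count_space UNIV)"
    proof (rule ennreal_le_epsilon)
      fix r :: real assume "r > 0"
      with \<open>e \<longlonglongrightarrow> 0\<close> have "eventually (\<lambda>n. e n < r / 2) sequentially"
        by (intro order_tendstoD) auto
      then obtain M where M: "e M < r / 2"
        by (auto simp: eventually_sequentially)
      have "(pmf (p M) has_sum 1) UNIV"
        using has_sum_integral_measure_pmf[of "p M" "\<lambda>_. 1"] by simp
      hence "eventually (\<lambda>F. dist (\<Sum>y\<in>F. pmf (p M) y) 1 < r / 2) (finite_subsets_at_top UNIV)"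
        using \<open>r > 0\<close> unfolding has_sum_def by (intro tendstoD) auto
      then obtain F where F: "finite F" "dist (\<Sum>y\<in>F. pmf (p M) y) 1 < r / 2"
        unfolding eventually_finite_subsets_at_top by blast
      hence "measure (p M) F > 1 - r / 2"
        by (simp add: measure_measure_pmf_finite dist_real_def abs_if split: if_splits)
      hence "measure (p m) F \<ge> 1 - r" if "m \<ge> M" for m
        using cauchy[OF that, of F] M by linarith
      hence "1 - r \<le> (\<Sum>y\<in>F. l y)"
        by (intro LIMSEQ_le_const[OF l_sum[OF F(1)]]) auto
      hence "1 \<le> ennreal ((\<Sum>y\<in>F. l y) + r)"
        by (simp add: ennreal_ge_1)
      also have "\<dots> = (\<Sum>y\<in>F. ennreal (l y)) + ennreal r"
        using l_nonneg \<open>r > 0\<close> by (simp add: sum_ennreal sum_nonneg)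
      also have "\<dots> \<le> (\<integral>\<^sup>+y. ennreal (l y) \<partial>count_space UNIV) + ennreal r"
        unfolding eq using F(1) by (intro add_right_mono SUP_upper) auto
      finally show "1 \<le> (\<integral>\<^sup>+y. ennreal (l y) \<partial>count_space UNIV) + ennreal r" .
    qed
  qed
  hence d: "pmf (embed_pmf l) y = l y" for y
    using l_nonneg by (intro pmf_embed_pmf) auto
  \<comment> \<open>Fatou gives only one inequality, but a probability mass function that lies below
    another one equals it.\<close>
  have "pmf (bind_pmf (embed_pmf l) K) y \<le> pmf (embed_pmf l) y" for y
  proof -
    have "ennreal (pmf (bind_pmf (embed_pmf l) K) y)
        = (\<integral>\<^sup>+z. ennreal (l z) * ennreal (pmf (K z) y) \<partial>count_space UNIV)"
      by (simp add: ennreal_pmf_bind nn_integral_measure_pmf d)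
    also have "\<dots> = (\<integral>\<^sup>+z. liminf (\<lambda>n. ennreal (pmf (p n) z) * ennreal (pmf (K z) y)) \<partial>count_space UNIV)"
    proof (intro nn_integral_cong)
      fix z
      have "(\<lambda>n. ennreal (pmf (p n) z * pmf (K z) y)) \<longlonglongrightarrow> ennreal (l z * pmf (K z) y)"
        by (intro tendsto_ennrealI tendsto_intros l)
      thus "ennreal (l z) * ennreal (pmf (K z) y)
          = liminf (\<lambda>n. ennreal (pmf (p n) z) * ennreal (pmf (K z) y))"
        using lim_imp_Liminf[OF sequentially_bot] l_nonneg by (metis (no_types, lifting) ennreal_mult' ext pmf_nonneg)
    qed
    also have "\<dots> \<le> liminf (\<lambda>n. \<integral>\<^sup>+z. ennreal (pmf (p n) z) * ennreal (pmf (K z) y) \<partial>count_space UNIV)"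
      by (rule nn_integral_liminf) simp
    also have "\<dots> = liminf (\<lambda>n. ennreal (pmf (p (Suc n)) y))"
      by (simp only: p_def kernel_pow_Suc' ennreal_pmf_bind nn_integral_measure_pmf)
    also have "\<dots> = ennreal (l y)"
      by (intro lim_imp_Liminf tendsto_ennrealI LIMSEQ_Suc l) simp
    finally show ?thesis
      using l_nonneg by (simp add: d)
  qed
  hence "bind_pmf (embed_pmf l) K = embed_pmf l"
    using pmf_neq_exists_less[of "embed_pmf l" "bind_pmf (embed_pmf l) K"] by (metis leD)
  thus ?thesis
    by (auto simp: stationary_def)
qed

lemma stationary_stat_dist: "stationary K (stat_dist K)"
proof -
  obtain d where d: "stationary K d"
    using ex_stationary by auto
  hence "stat_dist K = d"
    unfolding stat_dist_def by (rule the_equality) (rule stationary_unique[OF _ d])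
  with d show ?thesis
    by simp
qed

end

section \<open>The group inverse\<close>

context drift_chain
begin

abbreviation deviation where
  "deviation t x z \<equiv> pmf (kernel_pow K t x) z - pmf (stat_dist K) z"

text \<open>Invariance of \<open>d\<close> and row sums 1 make centring compatible with powers,
  except at \<open>t = 0\<close>, where the power is the identity matrix. The correction there is
  exactly what \<open>group_inverse\<close> subtracts, so the group inverse is the plain sum of the
  deviations.\<close>

lemma mat_pow_centered:
  "mat_pow (\<lambda>u v. pmf (K u) v - pmf (stat_dist K) v) t x z
    = deviation t x z + (if t = 0 then pmf (stat_dist K) z else 0)"
proof (induction t arbitrary: x)
  case 0
  show ?case
    by (auto simp: mat_id_def indicator_def)
next
  case (Suc t)
  let ?d = "stat_dist K"
  \<comment> \<open>Choosing \<open>c = 0\<close> at \<open>t = 0\<close> makes \<open>M\<close> the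
    column of the \<open>t\<close>-th power in that case too; the constant then cancels between the
    two probability measures.\<close>
  define c where "c = (if t = 0 then 0 else pmf ?d z)"
  define M where "M = (\<lambda>y. pmf (kernel_pow K t y) z - c)"
  have bd: "integrable (measure_pmf p) (\<lambda>y. pmf (kernel_pow K t y) z)" for p
    by (rule measure_pmf.integrable_const_bound[where B = 1]) (auto simp: pmf_le_1)
  hence int: "integrable (measure_pmf p) M" for p
    by (simp add: M_def)
  have "mat_pow (\<lambda>u v. pmf (K u) v - pmf ?d v) (Suc t) x z = (\<Sum>\<^sub>\<infinity>y. (pmf (K x) y - pmf ?d y) * M y)"
    using Suc by (auto simp: mat_mult_def M_def c_def intro!: infsum_cong)
  also have "\<dots> = (\<integral>y. M y \<partial>measure_pmf (K x)) - (\<integral>y. M y \<partial>measure_pmf ?d)"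
    by (rule infsum_pmf_diff[OF int int])
  also have "(\<integral>y. M y \<partial>measure_pmf (K x)) = pmf (kernel_pow K (Suc t) x) z - c"
    using bd by (simp add: M_def pmf_bind)
  also have "(\<integral>y. M y \<partial>measure_pmf ?d) = pmf ?d z - c"
    using bd pmf_bind[of ?d "kernel_pow K t" z]
    by (simp add: M_def stationary_kernel_pow[OF stationary_stat_dist])
  finally show ?case
    by simp
qed

lemma group_inverse_summability:
  obtains s where "summable s" "\<And>n. s n \<ge> 0"
    "\<And>x t. weighted_norm1 V (deviation t x) \<le> ennreal (s t * V x)"
    "\<And>x z t. \<bar>deviation t x z\<bar> \<le> s t * V x"
proof -
  obtain s where s: "summable s" "\<And>n. s n \<ge> 0"
    "\<And>f x n. (\<And>x. \<bar>f x\<bar> \<le> V x) \<Longrightarrow>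
       \<bar>(\<integral>u. f u \<partial>measure_pmf (kernel_pow K n x)) - (\<integral>u. f u \<partial>measure_pmf (stat_dist K))\<bar> \<le> s n * V x"
    by (rule convergence_to_stationary[OF stationary_stat_dist]) blast
  show thesis
  proof (rule that[OF s(1,2)])
    fix x z t
    show "weighted_norm1 V (deviation t x) \<le> ennreal (s t * V x)"
      unfolding weighted_norm1_pmf_diff[OF V_nonneg integrable_pow integrable_stationary[OF stationary_stat_dist]]
      by (intro ennreal_leI order_trans[OF abs_ge_self s(3)])
        (use V_nonneg in \<open>auto simp: abs_mult sgn_if\<close>)
    show "\<bar>deviation t x z\<bar> \<le> s t * V x"
      using s(3)[of "indicator {z}" t x, OF abs_indicator_le_V] by (simp add: measure_pmf_single)
  qed
qed

lemma summable_deviation: "summable (\<lambda>t. \<bar>deviation t x z\<bar>)"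
proof -
  obtain s where s: "summable s" "\<And>x z t. \<bar>deviation t x z\<bar> \<le> s t * V x"
    by (rule group_inverse_summability) blast
  show ?thesis
    by (rule summable_comparison_test'[where N = 0, OF summable_mult2[OF s(1), of "V x"]])
      (use s(2) in auto)
qed

lemma group_inverse_eq: "group_inverse K x z = (\<Sum>t. deviation t x z)"
proof -
  let ?a = "\<lambda>t. deviation t x z" and ?b = "\<lambda>t::nat. if t = 0 then pmf (stat_dist K) z else 0"
  have b: "?b sums pmf (stat_dist K) z"
    by (rule sums_single)
  have "(\<lambda>t. ?a t + ?b t) sums ((\<Sum>t. ?a t) + pmf (stat_dist K) z)"
    by (rule sums_add[OF summable_sums[OF summable_rabs_cancel[OF summable_deviation]] b])
  hence "fundamental_matrix K x z = (\<Sum>t. ?a t) + pmf (stat_dist K) z"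
    unfolding fundamental_matrix_def mat_pow_centered by (rule sums_unique[symmetric])
  thus ?thesis
    by (simp add: group_inverse_def)
qed

text \<open>Each row of deviations has norm at most \<open>s t * V x\<close>, and the rates are
  summable.\<close>

lemma group_inverse_row_bound:
  obtains c where "c \<ge> 0" "\<And>x. weighted_norm1 V (group_inverse K x) \<le> ennreal (c * V x)"
proof -
  obtain s where s: "summable s" "\<And>n. s n \<ge> 0"
    "\<And>x t. weighted_norm1 V (deviation t x) \<le> ennreal (s t * V x)"
    by (rule group_inverse_summability) blast
  show thesis
  proof (rule that)
    show "suminf s \<ge> 0"
      by (rule suminf_nonneg[OF s(1,2)])
    fix x
    have "ennreal (\<bar>group_inverse K x z\<bar> * V z) \<le> (\<Sum>t. ennreal (\<bar>deviation t x z\<bar> * V z))" for z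
    proof -
      have "\<bar>group_inverse K x z\<bar> * V z \<le> (\<Sum>t. \<bar>deviation t x z\<bar>) * V z"
        unfolding group_inverse_eq
        by (intro mult_right_mono summable_rabs summable_deviation V_nonneg)
      also have "\<dots> = (\<Sum>t. \<bar>deviation t x z\<bar> * V z)"
        by (rule suminf_mult2[OF summable_deviation])
      finally show ?thesis
        using V_nonneg by (subst suminf_ennreal2) (auto intro!: summable_mult2 summable_deviation ennreal_leI)
    qed
    hence "weighted_norm1 V (group_inverse K x)
        \<le> (\<integral>\<^sup>+z. (\<Sum>t. ennreal (\<bar>deviation t x z\<bar> * V z)) \<partial>count_space UNIV)"
      unfolding weighted_norm1_nn_integral by (intro nn_integral_mono)
    also have "\<dots> = (\<Sum>t. weighted_norm1 V (deviation t x))"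
      unfolding weighted_norm1_nn_integral by (rule nn_integral_suminf) simp
    also have "\<dots> \<le> (\<Sum>t. ennreal (s t * V x))"
      by (intro suminf_le s(3) summableI)
    also have "\<dots> = ennreal (\<Sum>t. s t * V x)"
      using s V_nonneg by (intro suminf_ennreal2) (auto intro: summable_mult2)
    also have "(\<Sum>t. s t * V x) = suminf s * V x"
      by (rule suminf_mult2[OF s(1), symmetric])
    finally show "weighted_norm1 V (group_inverse K x) \<le> ennreal (suminf s * V x)" .
  qed
qed

lemma ergodicity_coeff_group_inverse_finite: "ergodicity_coeff V (group_inverse K) < \<infinity>"
proof -
  obtain c where c: "c \<ge> 0" "\<And>x. weighted_norm1 V (group_inverse K x) \<le> ennreal (c * V x)"
    by (rule group_inverse_row_bound) blast
  have "ergodicity_coeff V (group_inverse K) \<le> ennreal c"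
    unfolding ergodicity_coeff_def
  proof (rule SUP_least)
    fix \<nu> assume "\<nu> \<in> {\<nu>. weighted_norm1 V \<nu> = 1 \<and> (\<Sum>\<^sub>\<infinity>x. \<nu> x) = 0}"
    thus "weighted_norm1 V (transpose_apply (group_inverse K) \<nu>) \<le> ennreal c"
      using weighted_norm1_transpose_apply_le[OF V_nonneg c, of \<nu>] by simp
  qed
  thus ?thesis
    by (auto intro: le_less_trans)
qed

text \<open>Along \<open>p - p K\<close> the series for the group inverse telescopes.\<close>

lemma transpose_apply_group_inverse:
  assumes p: "integrable (measure_pmf p) V"
  shows "transpose_apply (group_inverse K) (\<lambda>x. pmf p x - pmf (bind_pmf p K) x) z
    = pmf p z - pmf (stat_dist K) z"
proof -
  obtain s where s: "summable s" "\<And>n. s n \<ge> 0" "\<And>x z t. \<bar>deviation t x z\<bar> \<le> s t * V x"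
    by (rule group_inverse_summability) blast
  have dev_int: "integrable (measure_pmf q) (\<lambda>x. deviation t x z)" for q t
  proof (rule measure_pmf.integrable_const_bound[where B = 1])
    have "norm (deviation t x z) \<le> 1" for x
      using pmf_nonneg[of "kernel_pow K t x" z] pmf_le_1[of "kernel_pow K t x" z]
        pmf_nonneg[of "stat_dist K" z] pmf_le_1[of "stat_dist K" z]
      unfolding real_norm_def by linarith
    thus "AE x in measure_pmf q. norm (deviation t x z) \<le> 1"
      by simp
  qed simp
  have dev: "(\<integral>x. deviation t x z \<partial>measure_pmf q) = pmf (bind_pmf q (kernel_pow K t)) z - pmf (stat_dist K) z"
    for q t
  proof -
    have "integrable (measure_pmf q) (\<lambda>x. pmf (kernel_pow K t x) z)"
      by (rule measure_pmf.integrable_const_bound[where B = 1]) (auto simp: pmf_le_1)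
    thus ?thesis
      by (simp add: pmf_bind)
  qed
  \<comment> \<open>The series may be integrated term by term, since the deviations at time
    \<open>t\<close> are dominated by \<open>s t * V\<close> and \<open>V\<close> is
    \<open>q\<close>-integrable.\<close>
  have G: "integrable (measure_pmf q) (\<lambda>x. group_inverse K x z)"
    "(\<lambda>t. \<integral>x. deviation t x z \<partial>measure_pmf q) sums (\<integral>x. group_inverse K x z \<partial>measure_pmf q)"
    if q: "integrable (measure_pmf q) V" for q
  proof -
    have "summable (\<lambda>t. \<integral>x. \<bar>deviation t x z\<bar> \<partial>measure_pmf q)"
    proof (rule summable_comparison_test'[where N = 0])
      show "summable (\<lambda>t. s t * (\<integral>x. V x \<partial>measure_pmf q))"
        by (rule summable_mult2[OF s(1)])
      fix t
      have "(\<integral>x. \<bar>deviation t x z\<bar> \<partial>measure_pmf q) \<le> (\<integral>x. s t * V x \<partial>measure_pmf q)"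
        using dev_int q s(3) by (intro integral_mono) auto
      thus "norm (\<integral>x. \<bar>deviation t x z\<bar> \<partial>measure_pmf q) \<le> s t * (\<integral>x. V x \<partial>measure_pmf q)"
        by simp
    qed
    hence *: "summable (\<lambda>t. \<integral>x. norm (deviation t x z) \<partial>measure_pmf q)"
      by simp
    have **: "AE x in measure_pmf q. summable (\<lambda>t. norm (deviation t x z))"
      using summable_deviation by simp
    show "integrable (measure_pmf q) (\<lambda>x. group_inverse K x z)"
      "(\<lambda>t. \<integral>x. deviation t x z \<partial>measure_pmf q) sums (\<integral>x. group_inverse K x z \<partial>measure_pmf q)"
      unfolding group_inverse_eq
      using integrable_suminf[OF dev_int ** *] sums_integral[OF dev_int ** *] by auto
  qed
  let ?q = "bind_pmf p K"
  let ?a = "\<lambda>t. \<integral>x. deviation t x z \<partial>measure_pmf p"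
  have q: "integrable (measure_pmf ?q) V"
    by (rule integrable_bind_kernel[OF p])
  \<comment> \<open>A step before a deviation at time \<open>t\<close> yields a deviation at time
    \<open>t + 1\<close>, so the two series differ only in the term at time 0, and that term is
    \<open>p - d\<close>.\<close>
  have shift: "(\<integral>x. deviation t x z \<partial>measure_pmf ?q) = ?a (Suc t)" for t
  proof -
    have "bind_pmf ?q (kernel_pow K t) = bind_pmf p (kernel_pow K (Suc t))"
      unfolding bind_assoc_pmf by (intro bind_pmf_cong) auto
    thus ?thesis
      unfolding dev by simp
  qed
  have "transpose_apply (group_inverse K) (\<lambda>x. pmf p x - pmf ?q x) z
      = (\<Sum>\<^sub>\<infinity>x. (pmf p x - pmf ?q x) * group_inverse K x z)"
    unfolding transpose_apply_def by (simp only: mult.commute)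
  also have "\<dots> = (\<integral>x. group_inverse K x z \<partial>measure_pmf p) - (\<integral>x. group_inverse K x z \<partial>measure_pmf ?q)"
    by (rule infsum_pmf_diff[OF G(1)[OF p] G(1)[OF q]])
  also have "\<dots> = suminf ?a - (\<Sum>t. ?a (Suc t))"
    using sums_unique[OF G(2)[OF p]] sums_unique[OF G(2)[OF q]] unfolding shift by simp
  also have "\<dots> = ?a 0"
    using suminf_split_head[OF sums_summable[OF G(2)[OF p]]] by simp
  also have "\<dots> = pmf p z - pmf (stat_dist K) z"
  proof -
    have "kernel_pow K 0 = return_pmf"
      by (rule ext) simp
    thus ?thesis
      unfolding dev by (simp add: bind_return_pmf')
  qed
  finally show ?thesis .
qed

text \<open>\<open>p - p K\<close> has total mass 0 and finite norm, hence is governed by the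
  ergodicity coefficient, and the group inverse recovers \<open>p - d\<close> from it.\<close>

lemma weighted_norm1_stationary_perturbation:
  assumes p: "integrable (measure_pmf p) V"
  shows "weighted_norm1 V (\<lambda>z. pmf p z - pmf (stat_dist K) z)
    \<le> ergodicity_coeff V (group_inverse K) * weighted_norm1 V (\<lambda>x. pmf p x - pmf (bind_pmf p K) x)"
proof -
  have "(\<Sum>\<^sub>\<infinity>x. (pmf p x - pmf (bind_pmf p K) x) * 1) = 0"
    by (subst infsum_pmf_diff) auto
  hence "weighted_norm1 V (transpose_apply (group_inverse K) (\<lambda>x. pmf p x - pmf (bind_pmf p K) x))
      \<le> ergodicity_coeff V (group_inverse K) * weighted_norm1 V (\<lambda>x. pmf p x - pmf (bind_pmf p K) x)"
    by (intro weighted_norm1_transpose_apply_le_ergodicity_coeff V_pos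
          weighted_norm1_pmf_diff_less_top V_nonneg p integrable_bind_kernel) simp
  thus ?thesis
    unfolding transpose_apply_group_inverse[OF p] .
qed

text \<open>With coefficient 0 the perturbation bound makes every point mass equal to the stationary
  distribution, so there is only one state. This rules out a product 0 * \<infinity> in the final
  bound.\<close>

lemma ergodicity_coeff_eq_0_imp_eq:
  assumes "ergodicity_coeff V (group_inverse K) = 0"
  shows "p = stat_dist K"
proof -
  have point: "stat_dist K = return_pmf x" for x
  proof (rule pmf_eqI)
    fix z
    have "weighted_norm1 V (\<lambda>z. pmf (return_pmf x) z - pmf (stat_dist K) z) = 0"
      using weighted_norm1_stationary_perturbation[of "return_pmf x"] assms
      by (simp add: integrable_measure_pmf_finite)
    thus "pmf (stat_dist K) z = pmf (return_pmf x) z"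
      by (subst (asm) weighted_norm1_eq_0_iff[OF V_pos]) (metis eq_iff_diff_eq_0)
  qed
  have eq: "x = y" for x y :: 'x
    using point[of x] point[of y] by simp
  have "set_pmf p \<subseteq> {undefined}"
    using eq by (intro subsetI singletonI) simp
  thus ?thesis
    unfolding set_pmf_subset_singleton using point[of undefined] by simp
qed

end

section \<open>Average cost\<close>

section \<open>Markov decision processes with finitely many actions\<close>

lemma nn_integral_trajectory:
  fixes F :: "'x \<Rightarrow> 'a \<Rightarrow> real"
  assumes F: "\<And>x a. F x a \<ge> 0"
  shows "(\<integral>\<^sup>+h. ennreal (\<Sum>(x, a)\<leftarrow>h. F x a) \<partial>measure_pmf (trajectory P \<pi> N x))
    = (\<Sum>t<N. \<integral>\<^sup>+z. (\<integral>\<^sup>+a. ennreal (F z a) \<partial>measure_pmf (\<pi> z))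
        \<partial>measure_pmf (kernel_pow (policy_kernel P \<pi>) t x))"
proof (induction N arbitrary: x)
  case (Suc N)
  let ?K = "policy_kernel P \<pi>"
  let ?T = "\<lambda>h. \<Sum>(x, a)\<leftarrow>h. F x a"
  let ?I = "\<lambda>t x. \<integral>\<^sup>+z. (\<integral>\<^sup>+a. ennreal (F z a) \<partial>measure_pmf (\<pi> z)) \<partial>measure_pmf (kernel_pow ?K t x)"
  have T: "?T h \<ge> 0" for h
    using F by (intro sum_list_nonneg) auto
  have "(\<integral>\<^sup>+h. ennreal (?T h) \<partial>measure_pmf (trajectory P \<pi> (Suc N) x))
      = (\<integral>\<^sup>+a. (\<integral>\<^sup>+y. (\<integral>\<^sup>+h. ennreal (F x a) + ennreal (?T h) \<partial>measure_pmf (trajectory P \<pi> N y))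
          \<partial>measure_pmf (P x a)) \<partial>measure_pmf (\<pi> x))"
    using F T by (simp flip: ennreal_plus)
  also have "\<dots> = (\<integral>\<^sup>+a. ennreal (F x a) + (\<integral>\<^sup>+y. (\<Sum>t<N. ?I t y) \<partial>measure_pmf (P x a)) \<partial>measure_pmf (\<pi> x))"
    by (simp add: nn_integral_add Suc measure_pmf.emeasure_space_1)
  also have "\<dots> = (\<integral>\<^sup>+a. ennreal (F x a) \<partial>measure_pmf (\<pi> x)) + (\<integral>\<^sup>+y. (\<Sum>t<N. ?I t y) \<partial>measure_pmf (?K x))"
    by (simp add: nn_integral_add policy_kernel_def)
  also have "\<dots> = ?I 0 x + (\<Sum>t<N. ?I (Suc t) x)"
    by (simp add: nn_integral_sum)
  also have "\<dots> = (\<Sum>t<Suc N. ?I t x)"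
    by (rule sum.lessThan_Suc_shift[symmetric])
  finally show ?case .
qed simp

lemma expected_total_nonneg:
  fixes F :: "'x \<Rightarrow> 'a::finite \<Rightarrow> real"
  assumes F: "\<And>x a. F x a \<ge> 0"
    and int: "\<And>t. integrable (measure_pmf (bind_pmf \<mu> (kernel_pow (policy_kernel P \<pi>) t)))
        (\<lambda>z. \<integral>a. F z a \<partial>measure_pmf (\<pi> z))"
  shows "integrable (measure_pmf (bind_pmf \<mu> (trajectory P \<pi> N))) (\<lambda>h. \<Sum>(x, a)\<leftarrow>h. F x a)"
    and "expected_total P \<pi> F \<mu> N
      = (\<Sum>t<N. \<integral>z. (\<integral>a. F z a \<partial>measure_pmf (\<pi> z))
          \<partial>measure_pmf (bind_pmf \<mu> (kernel_pow (policy_kernel P \<pi>) t)))"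
proof -
  let ?K = "policy_kernel P \<pi>"
  let ?T = "\<lambda>h. \<Sum>(x, a)\<leftarrow>h. F x a" and ?M = "measure_pmf (bind_pmf \<mu> (trajectory P \<pi> N))"
  let ?J = "\<lambda>t. \<integral>z. (\<integral>a. F z a \<partial>measure_pmf (\<pi> z)) \<partial>measure_pmf (bind_pmf \<mu> (kernel_pow ?K t))"
  have T: "?T h \<ge> 0" for h
    using F by (intro sum_list_nonneg) auto
  have J: "?J t \<ge> 0" for t
    using F by (intro Bochner_Integration.integral_nonneg) auto
  have "(\<integral>\<^sup>+h. ennreal (?T h) \<partial>?M) = (\<Sum>t<N. \<integral>\<^sup>+z. (\<integral>\<^sup>+a. ennreal (F z a) \<partial>measure_pmf (\<pi> z))
        \<partial>measure_pmf (bind_pmf \<mu> (kernel_pow ?K t)))"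
    by (simp add: nn_integral_trajectory[OF F] nn_integral_sum)
  also have "\<dots> = (\<Sum>t<N. \<integral>\<^sup>+z. ennreal (\<integral>a. F z a \<partial>measure_pmf (\<pi> z))
        \<partial>measure_pmf (bind_pmf \<mu> (kernel_pow ?K t)))"
    by (intro sum.cong refl nn_integral_cong nn_integral_eq_integral integrable_measure_pmf_finite)
      (auto simp: F)
  also have "\<dots> = (\<Sum>t<N. ennreal (?J t))"
    by (intro sum.cong refl nn_integral_eq_integral int) (auto intro!: Bochner_Integration.integral_nonneg F)
  also have "\<dots> = ennreal (\<Sum>t<N. ?J t)"
    using J by (intro sum_ennreal) auto
  finally have *: "(\<integral>\<^sup>+h. ennreal (?T h) \<partial>?M) = ennreal (\<Sum>t<N. ?J t)" .
  show "integrable ?M ?T"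
    by (rule integrableI_nonneg) (use * T in auto)
  show "expected_total P \<pi> F \<mu> N = (\<Sum>t<N. ?J t)"
    unfolding expected_total_def
    by (rule integral_eq_nn_integral[THEN trans]) (use * T J in \<open>auto simp: sum_nonneg\<close>)
qed

text \<open>Reduction to nonnegative costs: \<open>g + V\<close> and \<open>V\<close> are both
  nonnegative with integrable means, and their difference is \<open>g\<close>.\<close>

lemma expected_total_dominated:
  fixes g :: "'x \<Rightarrow> 'a::finite \<Rightarrow> real"
  assumes g: "\<And>x a. \<bar>g x a\<bar> \<le> V x"
    and int: "\<And>t. integrable (measure_pmf (bind_pmf \<mu> (kernel_pow (policy_kernel P \<pi>) t))) V"
  shows "expected_total P \<pi> g \<mu> N
    = (\<Sum>t<N. \<integral>z. (\<integral>a. g z a \<partial>measure_pmf (\<pi> z))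
        \<partial>measure_pmf (bind_pmf \<mu> (kernel_pow (policy_kernel P \<pi>) t)))"
proof -
  let ?m = "\<lambda>t. measure_pmf (bind_pmf \<mu> (kernel_pow (policy_kernel P \<pi>) t))"
  have V: "V x \<ge> 0" and gV: "g x a + V x \<ge> 0" for x a
    using g[of x a] g[of x undefined] by auto
  have fin: "integrable (measure_pmf p) f" for p :: "'a pmf" and f :: "'a \<Rightarrow> real"
    by (rule integrable_measure_pmf_finite) simp
  have avg: "\<bar>\<integral>a. g z a \<partial>measure_pmf (\<pi> z)\<bar> \<le> V z" for z
  proof -
    have "\<bar>\<integral>a. g z a \<partial>measure_pmf (\<pi> z)\<bar> \<le> (\<integral>a. V z \<partial>measure_pmf (\<pi> z))"
      by (rule order_trans[OF integral_abs_bound integral_mono]) (use fin g in auto)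
    thus ?thesis by simp
  qed
  have gint: "integrable (?m t) (\<lambda>z. \<integral>a. g z a \<partial>measure_pmf (\<pi> z))" for t
    by (rule integrable_pmf_bounded[OF int avg])
  have sum_eq: "(\<integral>a. g z a + V z \<partial>measure_pmf (\<pi> z)) = (\<integral>a. g z a \<partial>measure_pmf (\<pi> z)) + V z" for z
    by (subst Bochner_Integration.integral_add) (use fin in auto)
  have 1: "integrable (?m t) (\<lambda>z. \<integral>a. g z a + V z \<partial>measure_pmf (\<pi> z))"
    "integrable (?m t) (\<lambda>z. \<integral>a. V z \<partial>measure_pmf (\<pi> z))" for t
    unfolding sum_eq using gint int by auto
  note A = expected_total_nonneg[of "\<lambda>z a. g z a + V z", OF gV 1(1)]
  note B = expected_total_nonneg[of "\<lambda>z a. V z", OF V 1(2)]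
  have split: "(\<Sum>(x, a)\<leftarrow>h. g x a) = (\<Sum>(x, a)\<leftarrow>h. g x a + V x) - (\<Sum>(x, a)\<leftarrow>h. V x)" for h
    by (induction h) auto
  have "expected_total P \<pi> g \<mu> N
      = expected_total P \<pi> (\<lambda>z a. g z a + V z) \<mu> N - expected_total P \<pi> (\<lambda>z a. V z) \<mu> N"
    unfolding expected_total_def split by (rule Bochner_Integration.integral_diff[OF A(1) B(1)])
  also have "\<dots> = (\<Sum>t<N. (\<integral>z. (\<integral>a. g z a \<partial>measure_pmf (\<pi> z)) + V z \<partial>?m t) - (\<integral>z. V z \<partial>?m t))"
    unfolding A(2) B(2) sum_eq by (simp add: sum_subtractf)
  also have "\<dots> = (\<Sum>t<N. \<integral>z. (\<integral>a. g z a \<partial>measure_pmf (\<pi> z)) \<partial>?m t)"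
    using gint int by (intro sum.cong refl) (subst Bochner_Integration.integral_add, auto)
  finally show ?thesis .
qed

text \<open>The expected cost at time \<open>t\<close> approaches the stationary mean with summable
  errors, so the total over \<open>N\<close> steps stays within a constant of \<open>N\<close> times
  that mean. In particular the limit in \<open>avg_cost\<close> exists.\<close>

lemma (in drift_chain) avg_cost_eq:
  fixes g :: "'x \<Rightarrow> 'a::finite \<Rightarrow> real"
  assumes K: "K = policy_kernel P \<pi>" and g: "\<And>x a. \<bar>g x a\<bar> \<le> V x" and \<mu>: "integrable (measure_pmf \<mu>) V"
  shows "avg_cost P g \<mu> \<pi> = (\<integral>x. (\<integral>a. g x a \<partial>measure_pmf (\<pi> x)) \<partial>measure_pmf (stat_dist K))"
proof -
  define f where "f z = (\<integral>a. g z a \<partial>measure_pmf (\<pi> z))" for z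
  have f: "\<bar>f z\<bar> \<le> V z" for z
  proof -
    have "\<bar>f z\<bar> \<le> (\<integral>a. V z \<partial>measure_pmf (\<pi> z))"
      unfolding f_def
      by (rule order_trans[OF integral_abs_bound integral_mono])
        (use g in \<open>auto intro: integrable_measure_pmf_finite\<close>)
    thus ?thesis by simp
  qed
  let ?L = "\<integral>x. f x \<partial>measure_pmf (stat_dist K)"
  let ?m = "\<lambda>t. bind_pmf \<mu> (kernel_pow K t)"
  let ?a = "\<lambda>t. \<integral>z. f z \<partial>measure_pmf (?m t)"
  obtain s where s: "summable s" "\<And>n. s n \<ge> 0"
    "\<And>f x n. (\<And>x. \<bar>f x\<bar> \<le> V x) \<Longrightarrow>
       \<bar>(\<integral>u. f u \<partial>measure_pmf (kernel_pow K n x)) - (\<integral>u. f u \<partial>measure_pmf (stat_dist K))\<bar> \<le> s n * V x"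
    by (rule convergence_to_stationary[OF stationary_stat_dist]) blast
  let ?V = "\<integral>x. V x \<partial>measure_pmf \<mu>"
  have V\<mu>: "?V \<ge> 0"
    using V_nonneg by (intro Bochner_Integration.integral_nonneg) auto
  have a: "\<bar>?a t - ?L\<bar> \<le> s t * ?V" for t
  proof -
    let ?F = "\<lambda>x. \<integral>z. f z \<partial>measure_pmf (kernel_pow K t x)"
    have fint: "integrable (measure_pmf (?m t)) f"
      by (rule integrable_pmf_bounded[OF integrable_bind_kernel_pow[OF \<mu>] f])
    note F = integrable_bind_pmf_integral[OF fint]
    have "?a t - ?L = (\<integral>x. ?F x - ?L \<partial>measure_pmf \<mu>)"
      using F by (simp add: integral_bind_pmf_integrable[OF fint])
    also have "\<bar>\<dots>\<bar> \<le> (\<integral>x. s t * V x \<partial>measure_pmf \<mu>)"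
      by (rule order_trans[OF integral_abs_bound integral_mono]) (use F \<mu> s(3)[OF f] in auto)
    finally show ?thesis
      by simp
  qed
  have "(\<lambda>N. (\<Sum>t<N. ?a t) / real N - ?L) \<longlonglongrightarrow> 0"
  proof (rule Lim_null_comparison)
    show "(\<lambda>N. (suminf s * ?V) / real N) \<longlonglongrightarrow> 0"
      by (rule lim_const_over_n)
    show "eventually (\<lambda>N. norm ((\<Sum>t<N. ?a t) / real N - ?L) \<le> (suminf s * ?V) / real N) sequentially"
      using eventually_gt_at_top[of 0]
    proof eventually_elim
      case (elim N)
      have "\<bar>\<Sum>t<N. ?a t - ?L\<bar> \<le> (\<Sum>t<N. s t * ?V)"
        by (intro order_trans[OF sum_abs] sum_mono a)
      also have "\<dots> = (\<Sum>t<N. s t) * ?V"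
        by (simp add: sum_distrib_right)
      also have "\<dots> \<le> suminf s * ?V"
        by (intro mult_right_mono V\<mu> sum_le_suminf s) auto
      finally have *: "\<bar>(\<Sum>t<N. ?a t) - real N * ?L\<bar> \<le> suminf s * ?V"
        by (simp add: sum_subtractf)
      have "(\<Sum>t<N. ?a t) / real N - ?L = ((\<Sum>t<N. ?a t) - real N * ?L) / real N"
        using elim by (simp add: field_simps)
      thus ?case
        using * by (simp add: abs_divide divide_right_mono)
    qed
  qed
  hence lim: "(\<lambda>N. (\<Sum>t<N. ?a t) / real N) \<longlonglongrightarrow> ?L"
    by (simp add: LIM_zero_iff)
  have "expected_total P \<pi> g \<mu> N = (\<Sum>t<N. ?a t)" for N
    unfolding f_def K
    by (rule expected_total_dominated[OF g]) (use integrable_bind_kernel_pow[OF \<mu>] in \<open>simp add: K\<close>)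
  thus ?thesis
    unfolding avg_cost_def using limI[OF lim] by (simp add: f_def)
qed

lemma (in drift_chain) performance_difference:
  fixes g :: "'x \<Rightarrow> 'a::finite \<Rightarrow> real"
  assumes K: "K = policy_kernel P \<pi>\<^sub>2" and g: "\<And>x a. \<bar>g x a\<bar> \<le> V x" and \<mu>: "integrable (measure_pmf \<mu>) V"
    and int: "integrable (measure_pmf (stat_dist K)) (rel_value P g \<mu> \<pi>\<^sub>1)"
  shows "avg_cost P g \<mu> \<pi>\<^sub>2 - avg_cost P g \<mu> \<pi>\<^sub>1
    = (\<integral>x. (\<integral>a. advantage P g \<mu> \<pi>\<^sub>1 x a \<partial>measure_pmf (\<pi>\<^sub>2 x)) \<partial>measure_pmf (stat_dist K))"
proof -
  let ?d = "stat_dist K" and ?c = "avg_cost P g \<mu> \<pi>\<^sub>1"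
  define h where "h = rel_value P g \<mu> \<pi>\<^sub>1"
  define f where "f z = (\<integral>a. g z a \<partial>measure_pmf (\<pi>\<^sub>2 z))" for z
  have fin: "integrable (measure_pmf p) f" for p :: "'a pmf" and f :: "'a \<Rightarrow> real"
    by (rule integrable_measure_pmf_finite) simp
  have f: "\<bar>f z\<bar> \<le> V z" for z
  proof -
    have "\<bar>f z\<bar> \<le> (\<integral>a. V z \<partial>measure_pmf (\<pi>\<^sub>2 z))"
      unfolding f_def by (rule order_trans[OF integral_abs_bound integral_mono]) (use g fin in auto)
    thus ?thesis by simp
  qed
  have fint: "integrable (measure_pmf ?d) f"
    by (rule integrable_pmf_bounded[OF integrable_stationary[OF stationary_stat_dist] f])
  have bind: "bind_pmf ?d K = ?d"
    using stationary_stat_dist by (simp add: stationary_def)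
  have hint: "integrable (measure_pmf (bind_pmf ?d K)) h"
    using int by (simp add: bind h_def)
  \<comment> \<open>Integrability under \<open>d\<close> passes to \<open>K x\<close> only for
    \<open>d\<close>-almost every \<open>x\<close>; since \<open>d\<close> charges every state, this
    means for every \<open>x\<close>.\<close>
  have hK: "integrable (measure_pmf (K x)) h" for x
    using integrable_bind_pmf_AE[OF hint] stationary_irreducible_pos[OF stationary_stat_dist irr, of x]
    by (auto simp: AE_measure_pmf_iff set_pmf_iff)
  have "(\<integral>a. advantage P g \<mu> \<pi>\<^sub>1 x a \<partial>measure_pmf (\<pi>\<^sub>2 x)) = f x - ?c + (\<integral>y. h y \<partial>measure_pmf (K x)) - h x" for x
  proof -
    have "(\<integral>y. h y \<partial>measure_pmf (K x)) = (\<integral>a. (\<integral>y. h y \<partial>measure_pmf (P x a)) \<partial>measure_pmf (\<pi>\<^sub>2 x))"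
      using hK[of x] unfolding K policy_kernel_def by (rule integral_bind_pmf_integrable)
    thus ?thesis
      unfolding advantage_def h_def[symmetric] f_def using fin by simp
  qed
  hence "(\<integral>x. (\<integral>a. advantage P g \<mu> \<pi>\<^sub>1 x a \<partial>measure_pmf (\<pi>\<^sub>2 x)) \<partial>measure_pmf ?d)
      = (\<integral>x. f x - ?c + (\<integral>y. h y \<partial>measure_pmf (K x)) - h x \<partial>measure_pmf ?d)"
    by simp
  also have "\<dots> = (\<integral>x. f x \<partial>measure_pmf ?d) - ?c + (\<integral>y. h y \<partial>measure_pmf (bind_pmf ?d K)) - (\<integral>y. h y \<partial>measure_pmf ?d)"
    using fint integrable_bind_pmf_integral[OF hint] hint
    by (simp add: integral_bind_pmf_integrable[OF hint]) (simp add: bind)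
  also have "\<dots> = avg_cost P g \<mu> \<pi>\<^sub>2 - ?c"
    unfolding bind avg_cost_eq[OF K g \<mu>] f_def by simp
  finally show ?thesis
    by simp
qed

section \<open>Probability ratios of actions and the deviation between the policies\<close>

lemma nn_integral_count_space_measure_pmf_swap:
  fixes F :: "'y \<Rightarrow> 'z \<Rightarrow> ennreal"
  shows "(\<integral>\<^sup>+y. (\<integral>\<^sup>+x. F x y \<partial>measure_pmf p) \<partial>count_space UNIV)
    = (\<integral>\<^sup>+x. (\<integral>\<^sup>+y. F x y \<partial>count_space UNIV) \<partial>measure_pmf p)"
proof -
  let ?G = "\<lambda>(x, y). ennreal (pmf p x) * F x y"
  have "(\<integral>\<^sup>+y. (\<integral>\<^sup>+x. F x y \<partial>measure_pmf p) \<partial>count_space UNIV)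
      = (\<integral>\<^sup>+y. (\<integral>\<^sup>+x. ?G (x, y) \<partial>count_space UNIV) \<partial>count_space UNIV)"
    by (simp add: nn_integral_measure_pmf)
  also have "\<dots> = (\<integral>\<^sup>+x. (\<integral>\<^sup>+y. ?G (x, y) \<partial>count_space UNIV) \<partial>count_space UNIV)"
    using nn_integral_fst_count_space[of ?G] nn_integral_snd_count_space[of ?G] by simp
  also have "\<dots> = (\<integral>\<^sup>+x. (\<integral>\<^sup>+y. F x y \<partial>count_space UNIV) \<partial>measure_pmf p)"
    by (simp add: nn_integral_measure_pmf nn_integral_cmult)
  finally show ?thesis .
qed

lemma integral_pmf_finite_type:
  fixes f :: "'a::finite \<Rightarrow> real"
  shows "(\<integral>a. f a \<partial>measure_pmf p) = (\<Sum>a\<in>UNIV. pmf p a * f a)"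
  by (subst integral_measure_pmf[of UNIV]) auto

lemma nn_integral_pmf_finite_type:
  fixes f :: "'a::finite \<Rightarrow> ennreal"
  shows "(\<integral>\<^sup>+a. f a \<partial>measure_pmf p) = (\<Sum>a\<in>UNIV. ennreal (pmf p a) * f a)"
  by (simp add: nn_integral_measure_pmf nn_integral_count_space_finite)

text \<open>Where \<open>pmf p a = 0\<close> the quotient has the default value 0, which is right
  because the support inclusion gives \<open>pmf q a = 0\<close> there.\<close>

lemma pmf_mult_ratio:
  assumes "set_pmf q \<subseteq> set_pmf p"
  shows "pmf p a * (pmf q a / pmf p a) = pmf q a"
    and "pmf p a * \<bar>pmf q a / pmf p a - 1\<bar> = \<bar>pmf q a - pmf p a\<bar>"
proof -
  have "pmf p a = 0 \<Longrightarrow> pmf q a = 0"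
    using assms by (auto simp: set_pmf_iff)
  thus *: "pmf p a * (pmf q a / pmf p a) = pmf q a"
    by (cases "pmf p a = 0") auto
  have "pmf p a * \<bar>pmf q a / pmf p a - 1\<bar> = \<bar>pmf p a * (pmf q a / pmf p a - 1)\<bar>"
    by (simp add: abs_mult)
  thus "pmf p a * \<bar>pmf q a / pmf p a - 1\<bar> = \<bar>pmf q a - pmf p a\<bar>"
    unfolding right_diff_distrib * by simp
qed

lemma integral_importance_ratio:
  fixes f :: "'a::finite \<Rightarrow> real"
  assumes "set_pmf q \<subseteq> set_pmf p"
  shows "(\<integral>a. pmf q a / pmf p a * f a \<partial>measure_pmf p) = (\<integral>a. f a \<partial>measure_pmf q)"
  unfolding integral_pmf_finite_type mult.assoc[symmetric] pmf_mult_ratio[OF assms] ..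

text \<open>In \<open>w\<close> the ratio cancels against the weight \<open>\<pi>\<^sub>1\<close>,
  leaving the absolute difference of the two policies summed over the actions. The first inequality
  carries the drift over to \<open>\<pi>\<^sub>1\<close> with error \<open>w\<close>; the second
  measures the effect of replacing one kernel by the other for a single step from
  \<open>d\<close>.\<close>

lemma
  fixes P :: "'x::countable \<Rightarrow> 'a::finite \<Rightarrow> 'x pmf"
  assumes V: "\<And>x. V x \<ge> 0" and ratio: "\<And>x. set_pmf (\<pi>\<^sub>2 x) \<subseteq> set_pmf (\<pi>\<^sub>1 x)"
  defines "w \<equiv> \<lambda>x. \<integral>\<^sup>+a. (\<integral>\<^sup>+y. ennreal (\<bar>pmf (\<pi>\<^sub>2 x) a / pmf (\<pi>\<^sub>1 x) a - 1\<bar> * V y)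
      \<partial>measure_pmf (P x a)) \<partial>measure_pmf (\<pi>\<^sub>1 x)"
  shows nn_integral_policy_kernel_le:
      "(\<integral>\<^sup>+y. V y \<partial>measure_pmf (policy_kernel P \<pi>\<^sub>1 x))
        \<le> (\<integral>\<^sup>+y. V y \<partial>measure_pmf (policy_kernel P \<pi>\<^sub>2 x)) + w x"
    and weighted_norm1_policy_kernel_le:
      "weighted_norm1 V (\<lambda>y. pmf (bind_pmf d (policy_kernel P \<pi>\<^sub>1)) y - pmf (bind_pmf d (policy_kernel P \<pi>\<^sub>2)) y)
        \<le> (\<integral>\<^sup>+x. w x \<partial>measure_pmf d)"
proof -
  let ?r = "\<lambda>x a. \<bar>pmf (\<pi>\<^sub>2 x) a / pmf (\<pi>\<^sub>1 x) a - 1\<bar>"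
  let ?I = "\<lambda>x a. \<integral>\<^sup>+y. V y \<partial>measure_pmf (P x a)"
  have w: "w x = (\<Sum>a\<in>UNIV. ennreal \<bar>pmf (\<pi>\<^sub>2 x) a - pmf (\<pi>\<^sub>1 x) a\<bar> * ?I x a)" for x
  proof -
    have "w x = (\<Sum>a\<in>UNIV. ennreal (pmf (\<pi>\<^sub>1 x) a) * (ennreal (?r x a) * ?I x a))"
      unfolding w_def nn_integral_pmf_finite_type by (simp add: ennreal_mult' nn_integral_cmult)
    also have "\<dots> = (\<Sum>a\<in>UNIV. ennreal (pmf (\<pi>\<^sub>1 x) a * ?r x a) * ?I x a)"
      by (simp add: ennreal_mult' mult.assoc)
    finally show ?thesis
      unfolding pmf_mult_ratio(2)[OF ratio] .
  qed
  have "(\<integral>\<^sup>+y. V y \<partial>measure_pmf (policy_kernel P \<pi>\<^sub>1 x)) = (\<Sum>a\<in>UNIV. ennreal (pmf (\<pi>\<^sub>1 x) a) * ?I x a)"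
    by (simp add: policy_kernel_def nn_integral_pmf_finite_type)
  also have "\<dots> \<le> (\<Sum>a\<in>UNIV. ennreal (pmf (\<pi>\<^sub>2 x) a + \<bar>pmf (\<pi>\<^sub>2 x) a - pmf (\<pi>\<^sub>1 x) a\<bar>) * ?I x a)"
    by (intro sum_mono mult_right_mono ennreal_leI) auto
  also have "\<dots> = (\<Sum>a\<in>UNIV. ennreal (pmf (\<pi>\<^sub>2 x) a) * ?I x a) + w x"
    by (simp add: w ennreal_plus distrib_right sum.distrib del: ennreal_plus_if)
  also have "(\<Sum>a\<in>UNIV. ennreal (pmf (\<pi>\<^sub>2 x) a) * ?I x a) = (\<integral>\<^sup>+y. V y \<partial>measure_pmf (policy_kernel P \<pi>\<^sub>2 x))"
    by (simp add: policy_kernel_def nn_integral_pmf_finite_type)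
  finally show "(\<integral>\<^sup>+y. V y \<partial>measure_pmf (policy_kernel P \<pi>\<^sub>1 x))
      \<le> (\<integral>\<^sup>+y. V y \<partial>measure_pmf (policy_kernel P \<pi>\<^sub>2 x)) + w x" .

  let ?\<nu> = "\<lambda>y. pmf (bind_pmf d (policy_kernel P \<pi>\<^sub>1)) y - pmf (bind_pmf d (policy_kernel P \<pi>\<^sub>2)) y"
  let ?D = "\<lambda>x y. pmf (policy_kernel P \<pi>\<^sub>1 x) y - pmf (policy_kernel P \<pi>\<^sub>2 x) y"
  let ?S = "\<lambda>x y. \<Sum>a\<in>UNIV. \<bar>pmf (\<pi>\<^sub>2 x) a - pmf (\<pi>\<^sub>1 x) a\<bar> * pmf (P x a) y"
  have D: "\<bar>?D x y\<bar> \<le> ?S x y" for x y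
  proof -
    have "?D x y = (\<Sum>a\<in>UNIV. (pmf (\<pi>\<^sub>1 x) a - pmf (\<pi>\<^sub>2 x) a) * pmf (P x a) y)"
      by (simp add: policy_kernel_def pmf_bind integral_pmf_finite_type sum_subtractf left_diff_distrib)
    thus ?thesis
      by (auto intro!: order_trans[OF sum_abs] sum_mono simp: abs_mult abs_minus_commute)
  qed
  have "ennreal (\<bar>?\<nu> y\<bar> * V y) \<le> (\<integral>\<^sup>+x. ennreal (?S x y * V y) \<partial>measure_pmf d)" for y
  proof -
    have int: "integrable (measure_pmf d) (\<lambda>x. pmf (k x) y)" for k :: "'x \<Rightarrow> 'x pmf"
      by (rule measure_pmf.integrable_const_bound[where B = 1]) (auto simp: pmf_le_1)
    have "ennreal \<bar>?\<nu> y\<bar> = ennreal (norm (\<integral>x. ?D x y \<partial>measure_pmf d))"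
      using int by (simp add: pmf_bind)
    also have "\<dots> \<le> (\<integral>\<^sup>+x. ennreal (norm (?D x y)) \<partial>measure_pmf d)"
      using int by (intro integral_norm_bound_ennreal) auto
    also have "\<dots> \<le> (\<integral>\<^sup>+x. ennreal (?S x y) \<partial>measure_pmf d)"
      using D by (intro nn_integral_mono ennreal_leI) simp
    finally have "ennreal \<bar>?\<nu> y\<bar> * ennreal (V y) \<le> (\<integral>\<^sup>+x. ennreal (?S x y) \<partial>measure_pmf d) * ennreal (V y)"
      by (intro mult_right_mono) auto
    thus ?thesis
      by (simp add: ennreal_mult'' V nn_integral_multc)
  qed
  hence "weighted_norm1 V ?\<nu> \<le> (\<integral>\<^sup>+y. (\<integral>\<^sup>+x. ennreal (?S x y * V y) \<partial>measure_pmf d) \<partial>count_space UNIV)"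
    unfolding weighted_norm1_nn_integral by (intro nn_integral_mono)
  also have "\<dots> = (\<integral>\<^sup>+x. (\<integral>\<^sup>+y. ennreal (?S x y * V y) \<partial>count_space UNIV) \<partial>measure_pmf d)"
    by (rule nn_integral_count_space_measure_pmf_swap)
  also have "(\<lambda>x. \<integral>\<^sup>+y. ennreal (?S x y * V y) \<partial>count_space UNIV) = w"
  proof
    fix x
    have "ennreal (?S x y * V y)
        = (\<Sum>a\<in>UNIV. ennreal \<bar>pmf (\<pi>\<^sub>2 x) a - pmf (\<pi>\<^sub>1 x) a\<bar> * (ennreal (pmf (P x a) y) * ennreal (V y)))" for y
    proof -
      have "ennreal (?S x y * V y)
          = ennreal (\<Sum>a\<in>UNIV. \<bar>pmf (\<pi>\<^sub>2 x) a - pmf (\<pi>\<^sub>1 x) a\<bar> * (pmf (P x a) y * V y))"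
        by (simp add: sum_distrib_right mult.assoc)
      also have "\<dots> = (\<Sum>a\<in>UNIV. ennreal (\<bar>pmf (\<pi>\<^sub>2 x) a - pmf (\<pi>\<^sub>1 x) a\<bar> * (pmf (P x a) y * V y)))"
        using V by (intro sum_ennreal[symmetric]) auto
      finally show ?thesis
        by (simp add: ennreal_mult' V)
    qed
    thus "(\<integral>\<^sup>+y. ennreal (?S x y * V y) \<partial>count_space UNIV) = w x"
      unfolding w by (simp add: nn_integral_sum nn_integral_cmult nn_integral_measure_pmf)
  qed
  finally show "weighted_norm1 V ?\<nu> \<le> (\<integral>\<^sup>+x. w x \<partial>measure_pmf d)" .
qed

text \<open>\<open>ennreal\<close> cuts a negative \<open>x - y\<close> to 0, which is harmless for
  an upper bound, and an infinite \<open>z\<close> makes the claim trivial. The theorem can thus be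
  proved inside \<open>ennreal\<close>.\<close>

lemma ereal_le_add_enn2ereal:
  assumes "ennreal (x - y) \<le> z"
  shows "ereal x \<le> ereal y + enn2ereal z"
proof (cases z)
  case (real r)
  with assms show ?thesis
    by (simp add: enn2ereal_ennreal)
qed simp

theorem theorem4:
  fixes P :: "'x::countable \<Rightarrow> 'a::finite \<Rightarrow> 'x pmf"
    and g :: "'x \<Rightarrow> 'a \<Rightarrow> real"
    and \<mu> :: "'x pmf"
    and \<pi>\<^sub>1 \<pi>\<^sub>2 :: "'x \<Rightarrow> 'a pmf"
    and V :: "'x \<Rightarrow> real"
    and \<epsilon> b :: real
    and C :: "'x set"
    and d\<^sub>1 :: "'x pmf"
  assumes irr1: "irreducible_kernel (policy_kernel P \<pi>\<^sub>1)"
    and aper1: "aperiodic_kernel (policy_kernel P \<pi>\<^sub>1)"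
    and irr2: "irreducible_kernel (policy_kernel P \<pi>\<^sub>2)"
    and aper2: "aperiodic_kernel (policy_kernel P \<pi>\<^sub>2)"
    and V_ge_1: "\<And>x. V x \<ge> 1"
    and eps: "0 < \<epsilon>" "\<epsilon> < 1"
    and b: "b \<ge> 0"
    and C: "finite C"
    and drift: "drift_condition (policy_kernel P \<pi>\<^sub>2) V \<epsilon> b C"
    and g_le_V: "\<And>x a. \<bar>g x a\<bar> \<le> V x"
    and pos_rec: "positive_recurrent (policy_kernel P \<pi>\<^sub>1)"
    and stat1: "stationary (policy_kernel P \<pi>\<^sub>1) d\<^sub>1"
    and ratio_defined: "\<And>x. set_pmf (\<pi>\<^sub>2 x) \<subseteq> set_pmf (\<pi>\<^sub>1 x)"
    and init: "integrable (measure_pmf \<mu>) V"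
    and value_integrable:
      "integrable (measure_pmf (stat_dist (policy_kernel P \<pi>\<^sub>2))) (rel_value P g \<mu> \<pi>\<^sub>1)"
  shows "ergodicity_coeff V (group_inverse (policy_kernel P \<pi>\<^sub>2)) < \<infinity> \<and>
    ereal (avg_cost P g \<mu> \<pi>\<^sub>2 - avg_cost P g \<mu> \<pi>\<^sub>1)
      \<le> ereal (\<integral>x. (\<integral>a. pmf (\<pi>\<^sub>2 x) a / pmf (\<pi>\<^sub>1 x) a * advantage P g \<mu> \<pi>\<^sub>1 x a
                    \<partial>measure_pmf (\<pi>\<^sub>1 x)) \<partial>measure_pmf d\<^sub>1)
        + enn2ereal (2 * advantage_sup P g \<mu> \<pi>\<^sub>1 \<pi>\<^sub>2 V
            * ergodicity_coeff V (group_inverse (policy_kernel P \<pi>\<^sub>2))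
            * (\<integral>\<^sup>+x. (\<integral>\<^sup>+a. (\<integral>\<^sup>+y. ennreal (\<bar>pmf (\<pi>\<^sub>2 x) a / pmf (\<pi>\<^sub>1 x) a - 1\<bar> * V y)
                \<partial>measure_pmf (P x a)) \<partial>measure_pmf (\<pi>\<^sub>1 x)) \<partial>measure_pmf d\<^sub>1))"
proof (intro conjI ereal_le_add_enn2ereal)
  let ?K = "policy_kernel P \<pi>\<^sub>2"
  interpret drift_chain ?K V \<epsilon> b C
    using irr2 aper2 V_ge_1 eps b C drift by unfold_locales
  show "ergodicity_coeff V (group_inverse ?K) < \<infinity>"
    by (rule ergodicity_coeff_group_inverse_finite)
  let ?d = "stat_dist ?K"
  let ?\<tau> = "ergodicity_coeff V (group_inverse ?K)"
  let ?s = "advantage_sup P g \<mu> \<pi>\<^sub>1 \<pi>\<^sub>2 V"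
  let ?w = "\<lambda>x. \<integral>\<^sup>+a. (\<integral>\<^sup>+y. ennreal (\<bar>pmf (\<pi>\<^sub>2 x) a / pmf (\<pi>\<^sub>1 x) a - 1\<bar> * V y)
      \<partial>measure_pmf (P x a)) \<partial>measure_pmf (\<pi>\<^sub>1 x)"
  let ?E = "\<integral>\<^sup>+x. ?w x \<partial>measure_pmf d\<^sub>1"
  define A where "A x = (\<integral>a. advantage P g \<mu> \<pi>\<^sub>1 x a \<partial>measure_pmf (\<pi>\<^sub>2 x))" for x
  have \<nu>: "weighted_norm1 V (\<lambda>x. pmf d\<^sub>1 x - pmf (bind_pmf d\<^sub>1 ?K) x) \<le> ?E"
    using weighted_norm1_policy_kernel_le[where V = V and \<pi>\<^sub>1 = \<pi>\<^sub>1 and \<pi>\<^sub>2 = \<pi>\<^sub>2 and d = d\<^sub>1 and P = P, OF V_nonneg ratio_defined] stat1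
    by (simp add: stationary_def)
  have A_le: "ennreal (1 / V x * \<bar>A x\<bar>) \<le> ?s" for x
    unfolding advantage_sup_def A_def by (rule SUP_upper) simp
  have main: "ennreal ((\<integral>x. A x \<partial>measure_pmf ?d) - (\<integral>x. A x \<partial>measure_pmf d\<^sub>1)) \<le> 2 * ?s * ?\<tau> * ?E"
  \<comment> \<open>Outside this case \<open>?s\<close>, \<open>?\<tau>\<close> and
    \<open>?E\<close> are all nonzero, so an infinite factor makes the product infinite rather than
    0.\<close>
  proof (cases "d\<^sub>1 = ?d \<or> ?s = 0")
    case True
    have "A x = 0" if "?s = 0" for x
      using A_le[of x] V_pos[of x] that by (simp add: ennreal_eq_0_iff mult_le_0_iff divide_le_0_iff)
    with True show ?thesis
      by auto
  next
    case False
    have "?\<tau> \<noteq> 0"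
      using False ergodicity_coeff_eq_0_imp_eq by blast
    \<comment> \<open>A vanishing deviation would make \<open>d\<^sub>1\<close> invariant for
      \<open>?K\<close> and hence equal to \<open>?d\<close>.\<close>
    moreover have "?E \<noteq> 0"
    proof
      assume "?E = 0"
      with \<nu> have "pmf d\<^sub>1 x = pmf (bind_pmf d\<^sub>1 ?K) x" for x
        using weighted_norm1_eq_0_iff[of V "\<lambda>x. pmf d\<^sub>1 x - pmf (bind_pmf d\<^sub>1 ?K) x"] V_pos by simp
      hence "stationary ?K d\<^sub>1"
        unfolding stationary_def by (intro pmf_eqI) simp
      with False show False
        using stationary_unique stationary_stat_dist by blast
    qed
    ultimately have inf: "2 * ?s * ?\<tau> * ?E = \<infinity>" if "?s = \<infinity> \<or> ?E = \<infinity>"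
      using False that by (auto simp: ennreal_mult_eq_top_iff)
    show ?thesis
    proof (cases "?s = \<infinity> \<or> ?E = \<infinity>")
      case True
      thus ?thesis
        using inf by simp
    next
      case finite: False
      \<comment> \<open>The drift of \<open>?K\<close> holds for the kernel of
        \<open>\<pi>\<^sub>1\<close> with error \<open>b + ?w x\<close>, whose
        \<open>d\<^sub>1\<close>-integral is finite because \<open>?E\<close> is.\<close>
      have "integrable (measure_pmf d\<^sub>1) V"
      proof (rule stationary_drift_integrable[OF stat1 V_nonneg eps, where u = "\<lambda>x. ennreal b + ?w x"])
        fix x
        have "(\<integral>\<^sup>+y. V y \<partial>measure_pmf (?K x)) \<le> ennreal (\<epsilon> * V x) + ennreal b"
          using integral_K'[of x] eps b V_nonneg
          by (simp add: nn_integral_eq_integral integrable_K ennreal_leI flip: ennreal_plus)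
        hence "(\<integral>\<^sup>+y. V y \<partial>measure_pmf (?K x)) + ?w x \<le> ennreal (\<epsilon> * V x) + ennreal b + ?w x"
          by (rule add_right_mono)
        with nn_integral_policy_kernel_le[where V = V and P = P and x = x and \<pi>\<^sub>1 = \<pi>\<^sub>1 and \<pi>\<^sub>2 = \<pi>\<^sub>2, OF V_nonneg ratio_defined]
        show "(\<integral>\<^sup>+y. V y \<partial>measure_pmf (policy_kernel P \<pi>\<^sub>1 x)) \<le> ennreal (\<epsilon> * V x) + (ennreal b + ?w x)"
          unfolding add.assoc by (rule order_trans)
        show "(\<integral>\<^sup>+x. ennreal b + ?w x \<partial>measure_pmf d\<^sub>1) < \<infinity>"
          using finite by (subst nn_integral_add) (auto simp: top.not_eq_extremum)
      qed
      note d1 = this and d2 = integrable_stationary[OF stationary_stat_dist]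
      obtain c where c: "c \<ge> 0" "?s = ennreal c"
        using finite by (cases ?s) auto
      have "\<bar>A x\<bar> \<le> c * V x" for x
        using A_le[of x] V_pos[of x] c by (simp add: field_simps)
      hence "ennreal ((\<integral>x. A x \<partial>measure_pmf ?d) - (\<integral>x. A x \<partial>measure_pmf d\<^sub>1))
          \<le> ?s * weighted_norm1 V (\<lambda>x. pmf ?d x - pmf d\<^sub>1 x)"
        unfolding c(2) by (rule integral_diff_le_weighted_norm1[OF V_nonneg d2 d1 _ c(1)])
      also have "weighted_norm1 V (\<lambda>x. pmf ?d x - pmf d\<^sub>1 x) = weighted_norm1 V (\<lambda>x. pmf d\<^sub>1 x - pmf ?d x)"
        unfolding weighted_norm1_def by (simp only: abs_minus_commute)
      also have "?s * \<dots> \<le> ?s * (?\<tau> * ?E)"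
        by (intro mult_left_mono order_trans[OF weighted_norm1_stationary_perturbation[OF d1]] \<nu>) auto
      \<comment> \<open>The estimate is complete without the factor 2, which is inserted here to
        match the stated form.\<close>
      also have "\<dots> \<le> 2 * (?s * (?\<tau> * ?E))"
        using mult_right_mono[of 1 2 "?s * (?\<tau> * ?E)"] by simp
      finally show ?thesis
        by (simp only: mult.assoc)
    qed
  qed
  \<comment> \<open>Reweighting turns the average over actions under \<open>\<pi>\<^sub>1\<close>
    into one under \<open>\<pi>\<^sub>2\<close>, so the subtracted integral is the mean of
    \<open>A\<close> under \<open>d\<^sub>1\<close>.\<close>
  show "ennreal (avg_cost P g \<mu> \<pi>\<^sub>2 - avg_cost P g \<mu> \<pi>\<^sub>1
      - (\<integral>x. (\<integral>a. pmf (\<pi>\<^sub>2 x) a / pmf (\<pi>\<^sub>1 x) a * advantage P g \<mu> \<pi>\<^sub>1 x a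
          \<partial>measure_pmf (\<pi>\<^sub>1 x)) \<partial>measure_pmf d\<^sub>1)) \<le> 2 * ?s * ?\<tau> * ?E"
    unfolding integral_importance_ratio[OF ratio_defined]
      performance_difference[OF refl g_le_V init value_integrable]
    using main unfolding A_def .
qed

end
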